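(* Let $G$ be a finite simple graph with no isolated vertices such that its matching complex $M(G)$ is a 2-dimensional homology manifold without boundary. Then either (1) $G= K_{4,3}$ and $M(G)$ is a triangulation of the torus $T^2$, or (2) $G\in\{3P_3,\ P_3\sqcup C_5,\ P_3\sqcup K_{3,2}\}$ and $M(G)$ is a triangulation of the sphere $S^2$. (Equality of graphs means isomorphism.)
   Context: A matching of a graph $G$ is a set of edges of $G$ no two of which share a vertex. The matching complex $M(G)$ is the simplicial complex whose vertices are the edges of $G$ and whose faces are the matchings of $G$ (including the empty matching). $P_n$ is the path with $n$ vertices, $C_n$ the cycle with $n$ vertices, $K_{m,n}$ the complete bipartite graph; $\sqcup$ is disjoint union and $nH$ denotes $n$ disjoint copies of $H$. For a face $\sigma$ of a simplicial complex $\Delta$, $\mathrm{link}_\Delta\sigma=\{\tau\in\Delta:\tau\cup\sigma\in\Delta,\ \tau\cap\sigma=\varnothing\}$. Fix a field $\Bbbk$; homology is taken over $\Bbbk$. A homology manifold (without boundary) is a (finite) $d$-dimensional simplicial complex $\Delta$ such that $\mathrm{link}_\Delta\sigma$ has the homology of a $(d-|\sigma|)$-sphere for all nonempty faces $\sigma\in\Delta$ (where the $(-1)$-sphere is the complex $\{\varnothing\}$). A triangulation of a space $X$ is a simplicial complex whose geometric realization is homeomorphic to $X$. *)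

theory Defs
  imports "HOL-Analysis.Analysis"
begin

section \<open>Graphs\<close>

datatype 'a ugraph = Graph (verts: "'a set") (edges: "'a set set")

definition finite_simple_graph :: "'a ugraph \<Rightarrow> bool" where
  "finite_simple_graph G \<longleftrightarrow>
     finite (verts G) \<and> (\<forall>e\<in>edges G. e \<subseteq> verts G \<and> card e = 2)"

definition no_isolated_vertices :: "'a ugraph \<Rightarrow> bool" where
  "no_isolated_vertices G \<longleftrightarrow> (\<forall>v\<in>verts G. \<exists>e\<in>edges G. v \<in> e)"

definition graph_iso :: "'a ugraph \<Rightarrow> 'b ugraph \<Rightarrow> bool" where
  "graph_iso G H \<longleftrightarrow>
     (\<exists>f. bij_betw f (verts G) (verts H) \<and> edges H = (\<lambda>e. f ` e) ` edges G)"

definition path_graph :: "nat \<Rightarrow> nat ugraph" where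
  "path_graph n = Graph {..<n} {{i, Suc i} | i. Suc i < n}"

text \<open>Only meaningful as a simple graph for \<open>n \<ge> 3\<close>.\<close>
definition cycle_graph :: "nat \<Rightarrow> nat ugraph" where
  "cycle_graph n = Graph {..<n} {{i, Suc i mod n} | i. i < n}"

definition complete_bipartite_graph :: "nat \<Rightarrow> nat \<Rightarrow> (nat + nat) ugraph" where
  "complete_bipartite_graph m n =
     Graph ({..<m} <+> {..<n}) {{Inl i, Inr j} | i j. i < m \<and> j < n}"

definition graph_union :: "'a ugraph \<Rightarrow> 'b ugraph \<Rightarrow> ('a + 'b) ugraph" where
  "graph_union G H =
     Graph (verts G <+> verts H) ((\<lambda>e. Inl ` e) ` edges G \<union> (\<lambda>e. Inr ` e) ` edges H)"

definition graph_copies :: "nat \<Rightarrow> 'a ugraph \<Rightarrow> (nat \<times> 'a) ugraph" where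
  "graph_copies n H = Graph ({..<n} \<times> verts H) {Pair i ` e | i e. i < n \<and> e \<in> edges H}"


section \<open>Simplicial complexes\<close>

definition finite_simplicial_complex :: "'v set set \<Rightarrow> bool" where
  "finite_simplicial_complex \<Delta> \<longleftrightarrow>
     finite \<Delta> \<and> (\<forall>\<sigma>\<in>\<Delta>. finite \<sigma>) \<and> {} \<in> \<Delta> \<and> (\<forall>\<sigma>\<in>\<Delta>. \<forall>\<tau>. \<tau> \<subseteq> \<sigma> \<longrightarrow> \<tau> \<in> \<Delta>)"

definition complex_dim :: "'v set set \<Rightarrow> int" where
  "complex_dim \<Delta> = int (Max (card ` \<Delta>)) - 1"

definition link :: "'v set set \<Rightarrow> 'v set \<Rightarrow> 'v set set" where
  "link \<Delta> \<sigma> = {\<tau> \<in> \<Delta>. \<tau> \<union> \<sigma> \<in> \<Delta> \<and> \<tau> \<inter> \<sigma> = {}}"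

definition matching_complex :: "'a ugraph \<Rightarrow> 'a set set set" where
  "matching_complex G = {M. M \<subseteq> edges G \<and> pairwise disjnt M}"

text \<open>Barycentric coordinates. The topology is that of pointwise convergence on
  \<open>'v \<Rightarrow> real\<close>, which for a finite complex is the usual one.\<close>
definition geometric_realization :: "'v set set \<Rightarrow> ('v \<Rightarrow> real) set" where
  "geometric_realization \<Delta> =
     {x. (\<forall>v. 0 \<le> x v) \<and> {v. x v \<noteq> 0} \<in> \<Delta> \<and> (\<Sum>v | x v \<noteq> 0. x v) = 1}"

definition triangulates :: "'v set set \<Rightarrow> 'b::topological_space set \<Rightarrow> bool" where
  "triangulates \<Delta> X \<longleftrightarrow>
     finite_simplicial_complex \<Delta> \<and> geometric_realization \<Delta> homeomorphic X"


section \<open>Reduced simplicial homology over a field\<close>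

text \<open>Oriented chains: a list of distinct vertices is an oriented simplex, and
  an \<open>i\<close>-chain is a function on the lists spanning the \<open>i\<close>-dimensional faces that changes
  sign whenever two adjacent entries are exchanged. The elementary chain of the oriented simplex
  \<open>xs\<close> is the one taking the value 1 at \<open>xs\<close> and 0 at the lists spanning other faces. The empty
  face is included in degree \<open>-1\<close>, which makes the homology reduced.\<close>
definition oriented_chains :: "'v set set \<Rightarrow> int \<Rightarrow> ('v list \<Rightarrow> 'k::field) set" where
  "oriented_chains \<Delta> i =
     {c. (\<forall>xs. c xs \<noteq> 0 \<longrightarrow> distinct xs \<and> set xs \<in> \<Delta> \<and> int (length xs) = i + 1) \<and>
         (\<forall>xs x y ys. c (xs @ x # y # ys) = - c (xs @ y # x # ys))}"

text \<open>On elementary chains this is the usual formula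
  \<open>[v\<^sub>0, \<dots>, v\<^sub>n] \<mapsto> \<Sum>j. (-1)^j [v\<^sub>0, \<dots>, v\<^sub>n without v\<^sub>j]\<close>: moving \<open>v\<^sub>j\<close> to the front
  of the list takes \<open>j\<close> exchanges.\<close>
definition boundary_map :: "'v set set \<Rightarrow> ('v list \<Rightarrow> 'k::field) \<Rightarrow> 'v list \<Rightarrow> 'k" where
  "boundary_map \<Delta> c xs = (\<Sum>v\<in>\<Union>\<Delta>. c (v # xs))"

definition cycles :: "'v set set \<Rightarrow> int \<Rightarrow> ('v list \<Rightarrow> 'k::field) set" where
  "cycles \<Delta> i = {z \<in> oriented_chains \<Delta> i. boundary_map \<Delta> z = (\<lambda>_. 0)}"

definition boundaries :: "'v set set \<Rightarrow> int \<Rightarrow> ('v list \<Rightarrow> 'k::field) set" where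
  "boundaries \<Delta> i = boundary_map \<Delta> ` oriented_chains \<Delta> (i + 1)"

definition homologous ::
    "'v set set \<Rightarrow> int \<Rightarrow> (('v list \<Rightarrow> 'k::field) \<times> ('v list \<Rightarrow> 'k)) set" where
  "homologous \<Delta> i =
     {(y, z). y \<in> cycles \<Delta> i \<and> z \<in> cycles \<Delta> i \<and> (\<lambda>xs. y xs - z xs) \<in> boundaries \<Delta> i}"

definition hom_class ::
    "'v set set \<Rightarrow> int \<Rightarrow> ('v list \<Rightarrow> 'k::field) \<Rightarrow> ('v list \<Rightarrow> 'k) set" where
  "hom_class \<Delta> i z = homologous \<Delta> i `` {z}"

definition reduced_homology ::
    "'v set set \<Rightarrow> int \<Rightarrow> ('v list \<Rightarrow> 'k::field) set set" where
  "reduced_homology \<Delta> i = cycles \<Delta> i // homologous \<Delta> i"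

definition homology_vanishes :: "'k::field itself \<Rightarrow> 'v set set \<Rightarrow> int \<Rightarrow> bool" where
  "homology_vanishes K \<Delta> i \<longleftrightarrow>
     (reduced_homology \<Delta> i :: ('v list \<Rightarrow> 'k) set set) = {hom_class \<Delta> i (\<lambda>_. 0)}"

text \<open>\<open>K\<close>-linear isomorphism of the reduced homology with \<open>K\<close>; the vector space operations on
  homology classes are given on representatives.\<close>
definition homology_iso_field :: "'k::field itself \<Rightarrow> 'v set set \<Rightarrow> int \<Rightarrow> bool" where
  "homology_iso_field K \<Delta> i \<longleftrightarrow>
     (\<exists>\<phi> :: ('v list \<Rightarrow> 'k) set \<Rightarrow> 'k.
        bij_betw \<phi> (reduced_homology \<Delta> i) UNIV \<and>
        (\<forall>y\<in>cycles \<Delta> i. \<forall>z\<in>cycles \<Delta> i.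
           \<phi> (hom_class \<Delta> i (\<lambda>xs. y xs + z xs)) = \<phi> (hom_class \<Delta> i y) + \<phi> (hom_class \<Delta> i z)) \<and>
        (\<forall>a. \<forall>z\<in>cycles \<Delta> i.
           \<phi> (hom_class \<Delta> i (\<lambda>xs. a * z xs)) = a * \<phi> (hom_class \<Delta> i z)))"

text \<open>The reduced homology of the \<open>m\<close>-sphere is \<open>K\<close> in degree \<open>m\<close> and 0 in all other degrees;
  this includes the \<open>-1\<close>-sphere, the complex whose only face is empty.\<close>
definition has_homology_of_sphere :: "'k::field itself \<Rightarrow> int \<Rightarrow> 'v set set \<Rightarrow> bool" where
  "has_homology_of_sphere K m \<Delta> \<longleftrightarrow>
     (\<forall>i. if i = m then homology_iso_field K \<Delta> i else homology_vanishes K \<Delta> i)"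

definition homology_manifold :: "'k::field itself \<Rightarrow> int \<Rightarrow> 'v set set \<Rightarrow> bool" where
  "homology_manifold K d \<Delta> \<longleftrightarrow>
     finite_simplicial_complex \<Delta> \<and> complex_dim \<Delta> = d \<and>
     (\<forall>\<sigma>\<in>\<Delta>. \<sigma> \<noteq> {} \<longrightarrow> has_homology_of_sphere K (d - int (card \<sigma>)) (link \<Delta> \<sigma>))"

end

theory Submission
  imports Defs
begin

text \<open>If \<open>e\<close> and \<open>f\<close> are disjoint edges of \<open>G\<close>, the link of the face
\<open>{e, f}\<close> in \<open>M(G)\<close> is a set of points, because \<open>M(G)\<close> has dimension 2;
having the homology of the 0-sphere, it consists of two points (\<open>card_vertices_of_S0\<close>). Hence
exactly two edges of \<open>G\<close> avoid \<open>e\<close> and \<open>f\<close>, and as there is no matching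
with four edges, these two share a vertex.

This determines \<open>G\<close>. Fix a matching with three edges \<open>c\<^sub>i l\<^sub>i\<close>. The
second edge that avoids the two others has the form \<open>c\<^sub>i x\<^sub>i\<close> with
\<open>x\<^sub>i\<close> outside the matching, so that every edge of \<open>G\<close> is one of these six or
joins two of the three matching edges (\<open>frame_edge_cases\<close>). If \<open>x\<^sub>i\<close> and
\<open>x\<^sub>j\<close> differ, no edge joins the arms \<open>i\<close> and \<open>j\<close>, since
\<open>l\<^sub>i\<close> and \<open>x\<^sub>i\<close> can be exchanged (\<open>frame_not_crossing\<close>).
Three different \<open>x\<^sub>i\<close> therefore give \<open>3P\<^sub>3\<close>. If exactly two of them
agree, counting the edges that avoid suitable pairs leaves \<open>C\<^sub>5\<close> or
\<open>K\<^sub>3\<^sub>,\<^sub>2\<close> beside a path; if all agree, it leaves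
\<open>K\<^sub>4\<^sub>,\<^sub>3\<close>.

For the topology, in the first three cases the two edges of one path are the poles, and the other edges,
arranged so that consecutive ones are the disjoint ones, form the equator of a suspended \<open>n\<close>-gon
with \<open>n = 4, 5, 6\<close>. For \<open>K\<^sub>4\<^sub>,\<^sub>3\<close>, label the point \<open>(a,
b)\<close> of the integer lattice by the edge from row \<open>(a mod 2, b mod 2)\<close> to column \<open>(a +
b) mod 3\<close>; this folds the standard triangulation of the plane by triangles onto
\<open>M(K\<^sub>4\<^sub>,\<^sub>3)\<close>, and two lattice points have the same label exactly if they differ
by an element of a sublattice of index 12. So in each case the realization is a quotient of a compact piece of
the plane, and it is identified with the sphere or the torus by comparing the fibres with those of an explicit
parametrization of that surface (\<open>quotient_realization\<close>).\<close>

section \<open>Quotients and realizations\<close>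

text \<open>A product of Hausdorff spaces is Hausdorff, so its compact subsets are closed.\<close>
lemma compact_imp_closed_fun:
  fixes C :: "('i \<Rightarrow> 'b::metric_space) set"
  assumes "compact C"
  shows "closed C"
proof -
  have "Hausdorff_space (euclidean :: ('i \<Rightarrow> 'b) topology)"
    unfolding euclidean_product_topology[symmetric] Hausdorff_space_product_topology by simp
  then show ?thesis
    using assms compactin_imp_closedin by (force simp flip: closed_closedin)
qed

text \<open>Two continuous images of one compact space with the same fibres are the same quotient of it. The maps
induced in both directions are continuous because images of closed subsets of \<open>K\<close> are compact and
hence closed.\<close>
lemma homeomorphic_of_equal_fibres:
  fixes f :: "'p::topological_space \<Rightarrow> 'x::topological_space"
    and g :: "'p \<Rightarrow> 'y::topological_space"
  assumes closed: "\<And>C :: 'x set. compact C \<Longrightarrow> closed C" "\<And>C :: 'y set. compact C \<Longrightarrow> closed C"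
    and K: "compact K" and f: "continuous_on K f" and g: "continuous_on K g"
    and eq: "\<And>a b. a \<in> K \<Longrightarrow> b \<in> K \<Longrightarrow> f a = f b \<longleftrightarrow> g a = g b"
  shows "f ` K homeomorphic g ` K"
proof -
  have cont: "continuous_on (f ` K) h"
    if f: "continuous_on K f" and g: "continuous_on K g" and h: "\<And>a. a \<in> K \<Longrightarrow> h (f a) = g a"
      and closed: "\<And>C :: 'u set. compact C \<Longrightarrow> closed C"
    for f :: "'p \<Rightarrow> 'u::topological_space" and g :: "'p \<Rightarrow> 'w::topological_space" and h
    unfolding continuous_on_closed_invariant
  proof (intro allI impI)
    fix B :: "'w set"
    assume "closed B"
    then obtain C where C: "closed C" "C \<inter> K = g -` B \<inter> K"
      using g unfolding continuous_on_closed_invariant by blast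
    have "compact (C \<inter> K)"
      using C(1) K by (rule closed_Int_compact)
    with C(2) have "compact (f ` (g -` B \<inter> K))"
      using f by (metis Int_lower2 compact_continuous_image continuous_on_subset)
    moreover have "f ` (g -` B \<inter> K) \<inter> f ` K = h -` B \<inter> f ` K"
      using h by auto
    ultimately show "\<exists>A. closed A \<and> A \<inter> f ` K = h -` B \<inter> f ` K"
      using closed by blast
  qed
  define h where "h x = g (inv_into K f x)" for x
  define k where "k y = f (inv_into K g y)" for y
  have h: "h (f a) = g a" if "a \<in> K" for a
    unfolding h_def using eq[of a "inv_into K f (f a)"] that
    by (metis f_inv_into_f imageI inv_into_into)
  have k: "k (g a) = f a" if "a \<in> K" for a
    unfolding k_def using eq[of a "inv_into K g (g a)"] that
    by (metis f_inv_into_f imageI inv_into_into)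
  show ?thesis
    unfolding homeomorphic_def homeomorphism_def
  proof (intro exI conjI)
    show "continuous_on (f ` K) h" "continuous_on (g ` K) k"
      using cont[OF f g h closed(1)] cont[OF g f k closed(2)] by blast+
  qed (use h k in \<open>auto simp: image_iff\<close>)
qed

text \<open>The affine extension of a vertex map to barycentric coordinates.\<close>
definition pushforward :: "('w \<Rightarrow> 'v) \<Rightarrow> ('w \<Rightarrow> real) \<Rightarrow> 'v \<Rightarrow> real" where
  "pushforward f x v = (\<Sum>w | x w \<noteq> 0 \<and> f w = v. x w)"

lemma pushforward_eq_sum:
  assumes "finite W" "{w. x w \<noteq> 0} \<subseteq> W"
  shows "pushforward f x v = (\<Sum>w\<in>W. if f w = v then x w else 0)"
proof -
  have "(\<Sum>w\<in>W. if f w = v then x w else 0) = sum x {w \<in> W. f w = v}"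
    using assms by (simp add: sum.inter_filter)
  also have "\<dots> = pushforward f x v"
    unfolding pushforward_def
    by (rule sum.mono_neutral_right) (use assms in auto)
  finally show ?thesis by simp
qed

lemma pushforward_at:
  assumes "finite W" "{w. x w \<noteq> 0} \<subseteq> W" "inj_on f W" "w \<in> W"
  shows "pushforward f x (f w) = x w"
proof -
  have "pushforward f x (f w) = (\<Sum>u\<in>W. if u = w then x u else 0)"
    unfolding pushforward_eq_sum[OF assms(1,2)]
    by (rule sum.cong) (use assms in \<open>auto dest: inj_onD\<close>)
  then show ?thesis using assms by simp
qed

lemma pushforward_outside:
  assumes "{w. x w \<noteq> 0} \<subseteq> W" "v \<notin> f ` W"
  shows "pushforward f x v = 0"
proof -
  have "{w. x w \<noteq> 0 \<and> f w = v} = {}" using assms by auto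
  then show ?thesis unfolding pushforward_def by (simp only: sum.empty)
qed

text \<open>A vertex map that is injective on a set of vertices loses nothing of the points supported there. This
is applied to the star of a vertex, although the labellings used below identify vertices that are far
apart.\<close>
lemma pushforward_inj:
  assumes "finite W" "{w. x w \<noteq> 0} \<subseteq> W" "{w. y w \<noteq> 0} \<subseteq> W" "inj_on f W"
    and eq: "pushforward f x = pushforward f y"
  shows "x = y"
proof
  fix w
  show "x w = y w"
  proof (cases "w \<in> W")
    case True
    then show ?thesis
      using pushforward_at[OF assms(1,2,4)] pushforward_at[OF assms(1,3,4)] eq by metis
  next
    case False
    then have "x w = 0" "y w = 0" using assms(2,3) by blast+
    then show ?thesis by simp
  qed
qed

lemma pushforward_eqI:
  assumes W: "finite W" "{w. x w \<noteq> 0} \<subseteq> W" "inj_on f W"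
    and y: "{v. y v \<noteq> 0} \<subseteq> f ` W" "\<And>w. w \<in> W \<Longrightarrow> x w = y (f w)"
  shows "pushforward f x = y"
proof
  fix v
  show "pushforward f x v = y v"
  proof (cases "v \<in> f ` W")
    case True
    then obtain w where "w \<in> W" "v = f w"
      by blast
    then show ?thesis
      using pushforward_at[OF W] y(2) by simp
  next
    case False
    then have "y v = 0"
      using y(1) by blast
    then show ?thesis
      using pushforward_outside[OF W(2) False] by simp
  qed
qed

lemma pushforward_reindex:
  assumes \<tau>: "\<And>w. \<sigma> (\<tau> w) = w" "\<And>w. \<tau> (\<sigma> w) = w"
    and f: "\<And>w. f (\<tau> w) = f w" and y: "\<And>w. y (\<tau> w) = x w"
  shows "pushforward f y = pushforward f x"
proof
  fix v
  have "f (\<sigma> w) = f w" "x (\<sigma> w) = y w" for w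
    using f[of "\<sigma> w"] y[of "\<sigma> w"] \<tau> by simp_all
  then show "pushforward f y v = pushforward f x v"
    unfolding pushforward_def
    by (intro sum.reindex_bij_witness[where i = \<tau> and j = \<sigma>]) (use assms in auto)
qed

lemma pushforward_at_unique:
  assumes "\<And>u. f u = f w \<Longrightarrow> u = w"
  shows "pushforward f x (f w) = x w"
proof -
  have "pushforward f x (f w) = sum x (if x w \<noteq> 0 then {w} else {})"
    unfolding pushforward_def by (rule sum.cong) (use assms in auto)
  then show ?thesis
    by (simp split: if_splits)
qed

lemma pushforward_support:
  assumes "finite {w. x w \<noteq> 0}" "\<And>w. 0 \<le> x w"
  shows "{v. pushforward f x v \<noteq> 0} = f ` {w. x w \<noteq> 0}"
proof -
  have "pushforward f x v \<noteq> 0 \<longleftrightarrow> (\<exists>w. x w \<noteq> 0 \<and> f w = v)" for v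
    unfolding pushforward_def using assms
    by (subst sum_nonneg_eq_0_iff) auto
  then show ?thesis by auto
qed

lemma pushforward_realization:
  assumes x: "x \<in> geometric_realization \<Gamma>" and fin: "finite {w. x w \<noteq> 0}"
  shows "pushforward f x \<in> geometric_realization ((`) f ` \<Gamma>)"
proof -
  have nn: "\<And>w. 0 \<le> x w" and s: "{w. x w \<noteq> 0} \<in> \<Gamma>" and one: "(\<Sum>w | x w \<noteq> 0. x w) = 1"
    using x unfolding geometric_realization_def by auto
  have "(\<Sum>v | pushforward f x v \<noteq> 0. pushforward f x v)
      = (\<Sum>v\<in>f ` {w. x w \<noteq> 0}. \<Sum>w\<in>{w \<in> {w. x w \<noteq> 0}. f w = v}. x w)"
    unfolding pushforward_support[OF fin nn] by (simp add: pushforward_def)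
  also have "\<dots> = 1"
    using one fin by (subst sum.image_gen[symmetric]) auto
  finally have "(\<Sum>v | pushforward f x v \<noteq> 0. pushforward f x v) = 1" .
  moreover have "{v. pushforward f x v \<noteq> 0} \<in> (`) f ` \<Gamma>"
    using s by (simp add: pushforward_support[OF fin nn])
  moreover have "0 \<le> pushforward f x v" for v
    unfolding pushforward_def using nn by (simp add: sum_nonneg)
  ultimately show ?thesis
    unfolding geometric_realization_def by simp
qed

lemma realization_sum:
  assumes "x \<in> geometric_realization \<Delta>" "finite W" "{v. x v \<noteq> 0} \<subseteq> W"
  shows "sum x W = 1"
proof -
  have "sum x W = (\<Sum>w | x w \<noteq> 0. x w)"
    by (rule sum.mono_neutral_right) (use assms in auto)
  then show ?thesis using assms(1) unfolding geometric_realization_def by simp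
qed

lemma continuous_on_pushforward:
  assumes "finite W" "\<And>p. p \<in> K \<Longrightarrow> {w. X p w \<noteq> 0} \<subseteq> W"
    and "\<And>w. w \<in> W \<Longrightarrow> continuous_on K (\<lambda>p. X p w)"
  shows "continuous_on K (\<lambda>p. pushforward f (X p))"
proof (rule continuous_on_coordinatewise_then_product)
  fix v
  have "continuous_on K (\<lambda>p. \<Sum>w\<in>W. if f w = v then X p w else 0)"
    proof (intro continuous_on_sum)
    fix w assume "w \<in> W"
    then show "continuous_on K (\<lambda>p. if f w = v then X p w else 0)"
      using assms(3) by (cases "f w = v") auto
  qed
  then show "continuous_on K (\<lambda>p. pushforward f (X p) v)"
    by (rule continuous_on_eq) (simp add: pushforward_eq_sum[OF assms(1,2)])
qed

lemma pushforward_inverse: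
  assumes A: "finite A" and gf: "\<And>a. a \<in> A \<Longrightarrow> g (f a) = a" and x: "{w. x w \<noteq> 0} \<subseteq> A"
  shows "pushforward g (pushforward f x) = x"
proof
  fix v
  have fA: "{w. pushforward f x w \<noteq> 0} \<subseteq> f ` A"
    using pushforward_outside[OF x, of _ f] by auto
  have f: "inj_on f A"
    using gf by (rule inj_on_inverseI)
  have g: "inj_on g (f ` A)"
    by (rule inj_on_inverseI[of _ f]) (use gf in auto)
  show "pushforward g (pushforward f x) v = x v"
  proof (cases "v \<in> A")
    case True
    have "pushforward g (pushforward f x) (g (f v)) = pushforward f x (f v)"
      using pushforward_at[OF _ fA g] A True by blast
    also have "\<dots> = x v"
      using pushforward_at[OF A x f True] .
    finally show ?thesis
      unfolding gf[OF True] .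
  next
    case False
    have "g ` f ` A = A"
      using gf by (force simp: image_image)
    with False have "v \<notin> g ` f ` A"
      by simp
    then have "pushforward g (pushforward f x) v = 0"
      by (rule pushforward_outside[OF fA])
    moreover have "x v = 0"
      using False x by blast
    ultimately show ?thesis
      by simp
  qed
qed

lemma realization_image_homeomorphic:
  assumes fin: "finite \<Delta>" "\<And>\<sigma>. \<sigma> \<in> \<Delta> \<Longrightarrow> finite \<sigma>" and inj: "inj_on f (\<Union>\<Delta>)"
  shows "geometric_realization \<Delta> homeomorphic geometric_realization ((`) f ` \<Delta>)"
proof -
  let ?g = "inv_into (\<Union>\<Delta>) f"
  have supp: "{w. x w \<noteq> 0} \<in> \<Delta>" if "x \<in> geometric_realization \<Delta>" for x and \<Delta> :: "'z set set"
    using that unfolding geometric_realization_def by simp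
  have finU: "finite (\<Union>\<Delta>)" using fin by blast
  have im: "(`) ?g ` (`) f ` \<Delta> = \<Delta>"
  proof -
    have "?g ` f ` \<sigma> = \<sigma>" if "\<sigma> \<in> \<Delta>" for \<sigma>
      using that inj by (simp add: Union_upper inv_into_image_cancel)
    then show ?thesis by (force simp: image_image)
  qed
  have U: "{v. y v \<noteq> 0} \<subseteq> f ` \<Union>\<Delta>" if "y \<in> geometric_realization ((`) f ` \<Delta>)" for y
    using supp[OF that] by blast
  show ?thesis
    unfolding homeomorphic_def homeomorphism_def
  proof (intro exI conjI ballI)
    show c1: "continuous_on (geometric_realization \<Delta>) (pushforward f)"
      by (rule continuous_on_pushforward[OF finU, where X="\<lambda>x. x"])
         (use supp in \<open>auto intro: continuous_on_subset[OF continuous_on_product_coordinates]\<close>)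
    show "continuous_on (geometric_realization ((`) f ` \<Delta>)) (pushforward ?g)"
      by (rule continuous_on_pushforward[where X="\<lambda>x. x" and W="f ` \<Union>\<Delta>"])
         (use finU U in \<open>auto intro: continuous_on_subset[OF continuous_on_product_coordinates]\<close>)
    show b1: "pushforward ?g (pushforward f x) = x" if "x \<in> geometric_realization \<Delta>" for x
      by (rule pushforward_inverse[OF finU]) (use supp[OF that] inj in auto)
    show b2: "pushforward f (pushforward ?g y) = y" if "y \<in> geometric_realization ((`) f ` \<Delta>)" for y
    proof (rule pushforward_inverse[where A="f ` \<Union>\<Delta>"])
      show "{w. y w \<noteq> 0} \<subseteq> f ` \<Union>\<Delta>"
        using U[OF that] .
    qed (use finU in \<open>auto simp: f_inv_into_f\<close>)
    have f1: "pushforward f x \<in> geometric_realization ((`) f ` \<Delta>)"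
      if "x \<in> geometric_realization \<Delta>" for x
      using pushforward_realization[OF that] supp[OF that] fin by blast
    have f2: "pushforward ?g y \<in> geometric_realization \<Delta>"
      if "y \<in> geometric_realization ((`) f ` \<Delta>)" for y
      using pushforward_realization[OF that, of ?g] supp[OF that] fin im by auto
    show "pushforward f ` geometric_realization \<Delta> = geometric_realization ((`) f ` \<Delta>)"
      by (rule subset_antisym)
         (use f1 in blast, rule subsetI, rule image_eqI[where f="pushforward f", OF b2[symmetric] f2])
    show "pushforward ?g ` geometric_realization ((`) f ` \<Delta>) = geometric_realization \<Delta>"
      by (rule subset_antisym)
         (use f2 in blast, rule subsetI, rule image_eqI[where f="pushforward ?g", OF b1[symmetric] f1])
  qed
qed

text \<open>The tool for both surfaces: \<open>X\<close> describes points of a parameter domain by their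
barycentric coordinates in some triangulation \<open>\<Gamma>\<close>, which may be infinite, and
\<open>f\<close> folds \<open>\<Gamma>\<close> onto a finite complex. It remains to compare the fibres of the
folded map with those of a known parametrization \<open>q\<close>.\<close>
lemma quotient_realization:
  fixes K :: "'p::topological_space set" and q :: "'p \<Rightarrow> 'q::t2_space"
  assumes K: "compact K"
    and W: "finite W" "\<And>p. p \<in> K \<Longrightarrow> {w. X p w \<noteq> 0} \<subseteq> W"
    and X: "\<And>w. continuous_on K (\<lambda>p. X p w)" "\<And>p. p \<in> K \<Longrightarrow> X p \<in> geometric_realization \<Gamma>"
    and surj: "\<And>y. y \<in> geometric_realization ((`) f ` \<Gamma>) \<Longrightarrow> \<exists>p\<in>K. pushforward f (X p) = y"
    and q: "continuous_on K q"
    and fibres: "\<And>a b. a \<in> K \<Longrightarrow> b \<in> K \<Longrightarrow> pushforward f (X a) = pushforward f (X b) \<longleftrightarrow> q a = q b"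
  shows "geometric_realization ((`) f ` \<Gamma>) homeomorphic q ` K"
proof -
  have "finite {w. X p w \<noteq> 0}" if "p \<in> K" for p
    using W that finite_subset by blast
  then have "pushforward f (X p) \<in> geometric_realization ((`) f ` \<Gamma>)" if "p \<in> K" for p
    using that X(2) pushforward_realization by blast
  then have "(\<lambda>p. pushforward f (X p)) ` K = geometric_realization ((`) f ` \<Gamma>)"
    using surj by blast
  moreover have "(\<lambda>p. pushforward f (X p)) ` K homeomorphic q ` K"
    using continuous_on_pushforward[OF W X(1)]
    by (intro homeomorphic_of_equal_fibres[OF compact_imp_closed_fun compact_imp_closed K _ q fibres]) auto
  ultimately show ?thesis by simp
qed

section \<open>The torus as a quotient of the triangulated plane\<close>

lemma cis_eq_iff: "cis a = cis b \<longleftrightarrow> (\<exists>n::int. a = b + 2 * pi * n)"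
proof -
  have "\<i> * complex_of_real a = \<i> * b + of_int (2 * n) * pi * \<i> \<longleftrightarrow> a = b + 2 * pi * n" for n :: int
    by (auto simp: complex_eq_iff)
  then show ?thesis
    unfolding cis_conv_exp exp_eq by simp
qed

lemma unit_circle_cis:
  assumes "norm z = 1"
  obtains \<theta> where "0 \<le> \<theta>" "\<theta> < 2 * pi" "z = cis \<theta>"
proof -
  have z: "z = cis (Arg z)"
    using assms cis_Arg[of z] by (cases "z = 0") (simp_all add: sgn_div_norm)
  have "- pi < Arg z" "Arg z \<le> pi"
    using Arg_bounded by auto
  then show ?thesis
    using z cis_eq_iff[of "Arg z + 2 * pi" "Arg z"] that[of "Arg z"] that[of "Arg z + 2 * pi"]
    by (cases "Arg z \<ge> 0") (auto intro: exI[of _ 1])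
qed

text \<open>The piecewise linear function that is 1 at the origin and 0 at all other lattice points, for the
triangulation of the plane with edges in the directions \<open>(1, 0)\<close>, \<open>(0, 1)\<close> and
\<open>(1, 1)\<close>.\<close>
definition hat :: "real \<Rightarrow> real \<Rightarrow> real" where
  "hat u v = max 0 (1 - (max 0 (max u v) - min 0 (min u v)))"

definition lattice_coords :: "real \<times> real \<Rightarrow> int \<times> int \<Rightarrow> real" where
  "lattice_coords p w = hat (fst p - fst w) (snd p - snd w)"

definition plane_triangulation :: "(int \<times> int) set set" where
  "plane_triangulation = {\<sigma>. \<exists>a b. \<sigma> \<subseteq> {(a, b), (a + 1, b), (a + 1, b + 1)} \<or>
                                   \<sigma> \<subseteq> {(a, b), (a, b + 1), (a + 1, b + 1)}}"

lemma int_cases_minus_one_zero: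
  fixes i :: int
  obtains "i \<le> -2" | "i = -1" | "i = 0" | "i \<ge> 1"
  by linarith

lemma hat_zero: "u \<ge> 1 \<or> u \<le> -1 \<or> v \<ge> 1 \<or> v \<le> -1 \<Longrightarrow> hat u v = 0"
  unfolding hat_def by linarith

lemma hat_commute: "hat u v = hat v u"
  unfolding hat_def by linarith

text \<open>With \<open>lattice_coords_upper\<close>, this says that the hat functions restrict to the barycentric
coordinates on each of the two triangles into which the diagonal divides a unit square.\<close>
lemma lattice_coords_lower:
  assumes "0 \<le> t" "t \<le> s" "s \<le> 1"
  shows "lattice_coords (of_int a + s, of_int b + t) =
    (\<lambda>w. if w = (a, b) then 1 - s else if w = (a + 1, b) then s - t
         else if w = (a + 1, b + 1) then t else 0)"
proof
  fix w :: "int \<times> int"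
  obtain i j where w: "w = (a - i, b - j)"
    by (rule that[of "a - fst w" "b - snd w"]) simp
  have "hat s t = 1 - s" "hat (s - 1) t = s - t" "hat (s - 1) (t - 1) = t" "hat s (t - 1) = 0"
    unfolding hat_def using assms by linarith+
  then have "hat (i + s) (j + t) = (if i = 0 \<and> j = 0 then 1 - s else if i = -1 \<and> j = 0 then s - t
         else if i = -1 \<and> j = -1 then t else 0)"
    by (cases i rule: int_cases_minus_one_zero; cases j rule: int_cases_minus_one_zero)
       (use assms in \<open>auto simp: hat_zero\<close>)
  moreover have "lattice_coords (of_int a + s, of_int b + t) w = hat (i + s) (j + t)"
    unfolding lattice_coords_def w by (simp add: algebra_simps)
  ultimately show "lattice_coords (of_int a + s, of_int b + t) w =
      (if w = (a, b) then 1 - s else if w = (a + 1, b) then s - t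
         else if w = (a + 1, b + 1) then t else 0)"
    unfolding w by auto
qed

lemma lattice_coords_upper:
  assumes "0 \<le> s" "s \<le> t" "t \<le> 1"
  shows "lattice_coords (of_int a + s, of_int b + t) =
    (\<lambda>w. if w = (a, b) then 1 - t else if w = (a, b + 1) then t - s
         else if w = (a + 1, b + 1) then s else 0)"
proof
  fix w :: "int \<times> int"
  have "lattice_coords (of_int a + s, of_int b + t) w
      = lattice_coords (of_int b + t, of_int a + s) (snd w, fst w)"
    unfolding lattice_coords_def fst_conv snd_conv by (rule hat_commute)
  also have "\<dots> = (if w = (a, b) then 1 - t else if w = (a, b + 1) then t - s
         else if w = (a + 1, b + 1) then s else 0)"
    unfolding fun_cong[OF lattice_coords_lower[OF assms, of b a]]
    by (simp add: prod_eq_iff conj_commute)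
  finally show "lattice_coords (of_int a + s, of_int b + t) w =
      (if w = (a, b) then 1 - t else if w = (a, b + 1) then t - s
         else if w = (a + 1, b + 1) then s else 0)" .
qed

lemma lattice_coords_cases:
  obtains w0 w1 w2 c0 c1 c2 where
    "{w0, w1, w2} \<in> plane_triangulation" "distinct [w0, w1, w2]"
    "0 \<le> c0" "0 \<le> c1" "0 \<le> c2" "c0 + c1 + c2 = 1"
    "lattice_coords p = (\<lambda>w. if w = w0 then c0 else if w = w1 then c1 else if w = w2 then c2 else 0)"
    "fst p = c0 * fst w0 + c1 * fst w1 + c2 * fst w2"
    "snd p = c0 * snd w0 + c1 * snd w1 + c2 * snd w2"
proof -
  define a where "a = \<lfloor>fst p\<rfloor>"
  define b where "b = \<lfloor>snd p\<rfloor>"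
  define s where "s = frac (fst p)"
  define t where "t = frac (snd p)"
  have p: "p = (of_int a + s, of_int b + t)"
    unfolding a_def b_def s_def t_def frac_def by simp
  have st: "0 \<le> s" "s \<le> 1" "0 \<le> t" "t \<le> 1"
    unfolding s_def t_def using frac_lt_1 less_imp_le by auto
  show ?thesis
  proof (cases "t \<le> s")
    case True
    show ?thesis
      by (rule that[of "(a, b)" "(a + 1, b)" "(a + 1, b + 1)" "1 - s" "s - t" t])
         (use True st lattice_coords_lower[OF st(3) True st(2), of a b] in
           \<open>auto simp: p plane_triangulation_def algebra_simps\<close>)
  next
    case False
    then have "s \<le> t" by simp
    then show ?thesis
      by (intro that[of "(a, b)" "(a, b + 1)" "(a + 1, b + 1)" "1 - t" "t - s" s])
         (use st lattice_coords_upper[OF st(1) \<open>s \<le> t\<close> st(4), of a b] in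
           \<open>auto simp: p plane_triangulation_def algebra_simps\<close>)
  qed
qed

lemma lattice_coords_nonneg: "0 \<le> lattice_coords p w"
  unfolding lattice_coords_def hat_def by simp

text \<open>A point is the barycenter of the lattice points weighted by its coordinates, so that the coordinates
determine it.\<close>
lemma
  shows finite_support_lattice_coords: "finite {w. lattice_coords p w \<noteq> 0}"
    and lattice_coords_realization: "lattice_coords p \<in> geometric_realization plane_triangulation"
    and lattice_coords_fst: "fst p = (\<Sum>w | lattice_coords p w \<noteq> 0. lattice_coords p w * fst w)"
    and lattice_coords_snd: "snd p = (\<Sum>w | lattice_coords p w \<noteq> 0. lattice_coords p w * snd w)"
proof -
  obtain w0 w1 w2 c0 c1 c2 where w: "{w0, w1, w2} \<in> plane_triangulation" "distinct [w0, w1, w2]"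
    and c: "0 \<le> c0" "0 \<le> c1" "0 \<le> c2" "c0 + c1 + c2 = 1"
    and X: "lattice_coords p = (\<lambda>w. if w = w0 then c0 else if w = w1 then c1 else if w = w2 then c2 else 0)"
    and p: "fst p = c0 * fst w0 + c1 * fst w1 + c2 * fst w2"
      "snd p = c0 * snd w0 + c1 * snd w1 + c2 * snd w2"
    by (rule lattice_coords_cases[of p])
  have supp: "{w. lattice_coords p w \<noteq> 0} \<subseteq> {w0, w1, w2}"
    by (auto simp: X split: if_splits)
  then show fin: "finite {w. lattice_coords p w \<noteq> 0}"
    using finite_subset by blast
  have sum: "(\<Sum>w | lattice_coords p w \<noteq> 0. lattice_coords p w * g w) = c0 * g w0 + c1 * g w1 + c2 * g w2"
    for g :: "int \<times> int \<Rightarrow> real"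
  proof -
    have "(\<Sum>w | lattice_coords p w \<noteq> 0. lattice_coords p w * g w)
        = (\<Sum>w\<in>{w0, w1, w2}. lattice_coords p w * g w)"
      by (rule sum.mono_neutral_left) (use supp in auto)
    also have "\<dots> = lattice_coords p w0 * g w0 + lattice_coords p w1 * g w1 + lattice_coords p w2 * g w2"
      using w(2) by simp
    moreover have "lattice_coords p w0 = c0" "lattice_coords p w1 = c1" "lattice_coords p w2 = c2"
      using w(2) fun_cong[OF X] by auto
    ultimately show ?thesis by simp
  qed
  show "fst p = (\<Sum>w | lattice_coords p w \<noteq> 0. lattice_coords p w * fst w)"
       "snd p = (\<Sum>w | lattice_coords p w \<noteq> 0. lattice_coords p w * snd w)"
    unfolding sum p by simp_all
  have "{w. lattice_coords p w \<noteq> 0} \<in> plane_triangulation"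
    using w(1) subset_trans[OF supp] unfolding plane_triangulation_def mem_Collect_eq by meson
  moreover have "(\<Sum>w | lattice_coords p w \<noteq> 0. lattice_coords p w) = 1"
    using sum[of "\<lambda>_. 1"] c by simp
  ultimately show "lattice_coords p \<in> geometric_realization plane_triangulation"
    unfolding geometric_realization_def using lattice_coords_nonneg by blast
qed

lemma lattice_coords_inj:
  assumes "lattice_coords p = lattice_coords q"
  shows "p = q"
proof (rule prod_eqI)
  show "fst p = fst q"
    unfolding lattice_coords_fst[of p] lattice_coords_fst[of q] assms ..
  show "snd p = snd q"
    unfolding lattice_coords_snd[of p] lattice_coords_snd[of q] assms ..
qed

text \<open>The vertices of the six triangles around a lattice point.\<close>
definition closed_star :: "int \<times> int \<Rightarrow> (int \<times> int) set" where
  "closed_star w = (\<lambda>h. w + h) ` {(0,0), (1,0), (1,1), (0,1), (-1,0), (-1,-1), (0,-1)}"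

lemma plane_triangulation_star:
  assumes "\<sigma> \<in> plane_triangulation" "u \<in> \<sigma>" "w \<in> \<sigma>"
  shows "u \<in> closed_star w"
proof -
  obtain a b where "\<sigma> \<subseteq> {(a, b), (a + 1, b), (a + 1, b + 1)} \<or> \<sigma> \<subseteq> {(a, b), (a, b + 1), (a + 1, b + 1)}"
    using assms(1) unfolding plane_triangulation_def by blast
  then consider "u \<in> {(a, b), (a + 1, b), (a + 1, b + 1)}" "w \<in> {(a, b), (a + 1, b), (a + 1, b + 1)}"
    | "u \<in> {(a, b), (a, b + 1), (a + 1, b + 1)}" "w \<in> {(a, b), (a, b + 1), (a + 1, b + 1)}"
    using assms by blast
  then have "u - w \<in> {(0,0), (1,0), (1,1), (0,1), (-1,0), (-1,-1), (0,-1)}"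
    by cases (auto simp: zero_prod_def)
  then show ?thesis
    unfolding closed_star_def by (intro image_eqI[of _ _ "u - w"]) simp_all
qed

lemma lattice_coords_star:
  assumes "lattice_coords p w \<noteq> 0"
  shows "{u. lattice_coords p u \<noteq> 0} \<subseteq> closed_star w"
proof (rule subsetI, rule plane_triangulation_star)
  show "{u. lattice_coords p u \<noteq> 0} \<in> plane_triangulation"
    using lattice_coords_realization[of p] unfolding geometric_realization_def by simp
qed (use assms in simp_all)

lemma lattice_coords_translate:
  "lattice_coords (fst p + of_int k, snd p + of_int l) (w + (k, l)) = lattice_coords p w"
  unfolding lattice_coords_def by simp

text \<open>The labels are the cosets of a sublattice of index 12, for which the closed star of a vertex is
embedded in the quotient.\<close>
definition torus_labelling :: "(int \<times> int \<Rightarrow> 'v) \<Rightarrow> bool" where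
  "torus_labelling f \<longleftrightarrow> (\<forall>a b c d. f (a, b) = f (c, d) \<longleftrightarrow>
     even (a - c) \<and> even (b - d) \<and> 3 dvd (a - c) + (b - d))"

lemma torus_labelling_inj_star:
  assumes "torus_labelling f"
  shows "inj_on f (closed_star w)"
proof -
  obtain a b where w: "w = (a, b)" by (cases w)
  show ?thesis
    using assms unfolding inj_on_def closed_star_def w torus_labelling_def by auto
qed

text \<open>Translations by the period lattice preserve the labels. Conversely, points with the same image can be
translated so that their supports share a vertex \<open>w\<close>; both supports then lie in the star of
\<open>w\<close>, where labels are injective.\<close>
lemma torus_labelling_fibres:
  fixes p q :: "real \<times> real"
  assumes f: "torus_labelling f"
  shows "pushforward f (lattice_coords p) = pushforward f (lattice_coords q) \<longleftrightarrow>
    (\<exists>k l :: int. even k \<and> even l \<and> 3 dvd k + l \<and> p = (fst q + k, snd q + l))" (is "?L \<longleftrightarrow> ?R")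
proof -
  have trans: "pushforward f (lattice_coords (fst q + k, snd q + l)) = pushforward f (lattice_coords q)"
    if "even k" "even l" "3 dvd k + l" for k l :: int
  proof (rule pushforward_reindex[where \<tau> = "\<lambda>w. w + (k, l)" and \<sigma> = "\<lambda>w. w - (k, l)"])
    show "f (w + (k, l)) = f w" for w
      using f that unfolding torus_labelling_def by (cases w) auto
  qed (auto simp: lattice_coords_translate)
  show ?thesis
  proof
    assume ?R then show ?L using trans by auto
  next
    assume eq: ?L
    note supp = pushforward_support[OF finite_support_lattice_coords lattice_coords_nonneg, where f = f]
    obtain a b where w: "lattice_coords p (a, b) \<noteq> 0"
    proof -
      have "{w. lattice_coords p w \<noteq> 0} \<noteq> {}"
        using lattice_coords_realization[of p] unfolding geometric_realization_def
        by (auto simp del: Collect_empty_eq)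
      then show ?thesis using that by auto
    qed
    have "f ` {w. lattice_coords p w \<noteq> 0} = f ` {w. lattice_coords q w \<noteq> 0}"
      using eq unfolding supp[symmetric] by simp
    with w have "f (a, b) \<in> f ` {w. lattice_coords q w \<noteq> 0}"
      by blast
    then obtain c d where w': "lattice_coords q (c, d) \<noteq> 0" "f (a, b) = f (c, d)"
      by auto
    then have kl: "even (a - c)" "even (b - d)" "3 dvd (a - c) + (b - d)"
      using f unfolding torus_labelling_def by auto
    let ?q = "(fst q + of_int (a - c), snd q + of_int (b - d))"
    have "lattice_coords ?q (a, b) = lattice_coords q (c, d)"
      using lattice_coords_translate[of q "a - c" "b - d" "(c, d)"] by simp
    then have "lattice_coords ?q (a, b) \<noteq> 0" using w' by simp
    moreover have "pushforward f (lattice_coords p) = pushforward f (lattice_coords ?q)"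
      using eq trans[OF kl] by simp
    moreover have "finite (closed_star (a, b))"
      unfolding closed_star_def by simp
    ultimately have "lattice_coords p = lattice_coords ?q"
      using pushforward_inj[OF _ lattice_coords_star[OF w] lattice_coords_star
          torus_labelling_inj_star[OF f]] by blast
    then show ?R
      using lattice_coords_inj kl by blast
  qed
qed

text \<open>The periods include \<open>(6, 0)\<close> and \<open>(0, 6)\<close>, so a triangle can be moved into
the square of side 6 without changing its labels.\<close>
lemma torus_labelling_surj:
  assumes f: "torus_labelling f" and y: "y \<in> geometric_realization ((`) f ` plane_triangulation)"
  shows "\<exists>p \<in> {0..6} \<times> {0..6}. pushforward f (lattice_coords p) = y"
proof -
  have nn: "0 \<le> y v" for v
    using y unfolding geometric_realization_def by blast
  obtain \<sigma> where "\<sigma> \<in> plane_triangulation" "{v. y v \<noteq> 0} = f ` \<sigma>"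
    using y unfolding geometric_realization_def by blast
  then obtain a b where ab: "{v. y v \<noteq> 0} \<subseteq> f ` {(a, b), (a + 1, b), (a + 1, b + 1)}
      \<or> {v. y v \<noteq> 0} \<subseteq> f ` {(a, b), (a, b + 1), (a + 1, b + 1)}"
    unfolding plane_triangulation_def by blast
  define c where "c = a mod 6"
  define d where "d = b mod 6"
  have cd: "0 \<le> c" "c \<le> 5" "0 \<le> d" "d \<le> 5"
    unfolding c_def d_def using pos_mod_bound[of 6 a] pos_mod_bound[of 6 b] by auto
  have "f (a + i, b + j) = f (c + i, d + j)" for i j
  proof -
    have "even (a + i - (c + i))" "even (b + j - (d + j))" "3 dvd (a + i - (c + i)) + (b + j - (d + j))"
      unfolding c_def d_def by presburger+
    then show ?thesis
      using f unfolding torus_labelling_def by blast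
  qed
  from this[of 0 0] this[of 1 0] this[of 0 1] this[of 1 1] ab
  consider (lower) "{v. y v \<noteq> 0} \<subseteq> f ` {(c, d), (c + 1, d), (c + 1, d + 1)}"
    | (upper) "{v. y v \<noteq> 0} \<subseteq> f ` {(c, d), (c, d + 1), (c + 1, d + 1)}"
    by auto
  then show ?thesis
  proof cases
    case lower
    let ?W = "{(c, d), (c + 1, d), (c + 1, d + 1)}"
    have inj: "inj_on f ?W"
      by (rule inj_on_subset[OF torus_labelling_inj_star[OF f, of "(c, d)"]]) (auto simp: closed_star_def)
    have "sum y (f ` ?W) = 1"
      by (rule realization_sum[OF y]) (use lower in auto)
    then have one: "y (f (c, d)) + (y (f (c + 1, d)) + y (f (c + 1, d + 1))) = 1"
      unfolding sum.reindex[OF inj] by simp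
    define t where "t = y (f (c + 1, d + 1))"
    define s where "s = y (f (c + 1, d)) + t"
    have st: "0 \<le> t" "t \<le> s" "s \<le> 1"
      using nn[of "f (c, d)"] nn[of "f (c + 1, d)"] nn[of "f (c + 1, d + 1)"] one
      unfolding s_def t_def by linarith+
    note X = lattice_coords_lower[OF st, of c d]
    have y: "y (f (c, d)) = 1 - s" "y (f (c + 1, d)) = s - t" "y (f (c + 1, d + 1)) = t"
      using one unfolding s_def t_def by linarith+
    have "pushforward f (lattice_coords (c + s, d + t)) = y"
      by (rule pushforward_eqI[of ?W, OF _ _ inj lower]) (auto simp: X y split: if_splits)
    moreover have "(c + s, d + t) \<in> {0..6} \<times> {0..6}"
      using st cd by auto
    ultimately show ?thesis ..
  next
    case upper
    let ?W = "{(c, d), (c, d + 1), (c + 1, d + 1)}"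
    have inj: "inj_on f ?W"
      by (rule inj_on_subset[OF torus_labelling_inj_star[OF f, of "(c, d)"]]) (auto simp: closed_star_def)
    have "sum y (f ` ?W) = 1"
      by (rule realization_sum[OF y]) (use upper in auto)
    then have one: "y (f (c, d)) + (y (f (c, d + 1)) + y (f (c + 1, d + 1))) = 1"
      unfolding sum.reindex[OF inj] by simp
    define s where "s = y (f (c + 1, d + 1))"
    define t where "t = y (f (c, d + 1)) + s"
    have st: "0 \<le> s" "s \<le> t" "t \<le> 1"
      using nn[of "f (c, d)"] nn[of "f (c, d + 1)"] nn[of "f (c + 1, d + 1)"] one
      unfolding s_def t_def by linarith+
    note X = lattice_coords_upper[OF st, of c d]
    have y: "y (f (c, d)) = 1 - t" "y (f (c, d + 1)) = t - s" "y (f (c + 1, d + 1)) = s"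
      using one unfolding s_def t_def by linarith+
    have "pushforward f (lattice_coords (c + s, d + t)) = y"
      by (rule pushforward_eqI[of ?W, OF _ _ inj upper]) (auto simp: X y split: if_splits)
    moreover have "(c + s, d + t) \<in> {0..6} \<times> {0..6}"
      using st cd by auto
    ultimately show ?thesis ..
  qed
qed

text \<open>The fibres of \<open>q\<close> are the cosets of the period lattice: the two angles agree if and only
if the first coordinates differ by an even number and the coordinate sums by a multiple of 6.\<close>
theorem torus_labelling_realization:
  assumes f: "torus_labelling f"
  shows "geometric_realization ((`) f ` plane_triangulation) homeomorphic
    sphere (0::complex) 1 \<times> sphere (0::complex) 1"
proof -
  define K :: "(real \<times> real) set" where "K = {0..6} \<times> {0..6}"
  define q where "q p = (cis (pi * fst p), cis (pi * (fst p + snd p) / 3))" for p :: "real \<times> real"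
  have "geometric_realization ((`) f ` plane_triangulation) homeomorphic q ` K"
  proof (rule quotient_realization[where X = lattice_coords and W = "{-1..7} \<times> {-1..7}"])
    show "compact K"
      unfolding K_def by (intro compact_Times compact_Icc)
    show "{w. lattice_coords p w \<noteq> 0} \<subseteq> {-1..7} \<times> {-1..7}" if "p \<in> K" for p
    proof
      fix w assume "w \<in> {w. lattice_coords p w \<noteq> 0}"
      then have "\<not> (fst p - fst w \<ge> 1 \<or> fst p - fst w \<le> -1 \<or> snd p - snd w \<ge> 1 \<or> snd p - snd w \<le> -1)"
        using hat_zero unfolding lattice_coords_def by blast
      then show "w \<in> {-1..7} \<times> {-1..7}"
        using that unfolding K_def by (cases w; cases p) auto
    qed
    show "continuous_on K (\<lambda>p. lattice_coords p w)" for w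
      unfolding lattice_coords_def hat_def by (intro continuous_intros)
    show "continuous_on K q"
      unfolding q_def by (intro continuous_intros) auto
    show "\<exists>p\<in>K. pushforward f (lattice_coords p) = y"
      if "y \<in> geometric_realization ((`) f ` plane_triangulation)" for y
      using torus_labelling_surj[OF f that] unfolding K_def .
    show "pushforward f (lattice_coords a) = pushforward f (lattice_coords b) \<longleftrightarrow> q a = q b" for a b
    proof -
      have "q a = q b \<longleftrightarrow> (\<exists>(m::int) (n::int). pi * fst a = pi * fst b + 2 * pi * m \<and>
          pi * (fst a + snd a) / 3 = pi * (fst b + snd b) / 3 + 2 * pi * n)"
        unfolding q_def by (simp add: cis_eq_iff)
      also have "\<dots> \<longleftrightarrow> (\<exists>(m::int) (n::int). fst a = fst b + 2 * of_int m \<and>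
          fst a + snd a = fst b + snd b + 6 * of_int n)"
      proof -
        have "pi * fst a = pi * fst b + 2 * pi * m \<longleftrightarrow> pi * (fst a - (fst b + 2 * of_int m)) = 0" for m :: int
          by (simp add: algebra_simps)
        then have "pi * fst a = pi * fst b + 2 * pi * m \<longleftrightarrow> fst a = fst b + 2 * of_int m" for m :: int
          by simp
        moreover have "pi * (fst a + snd a) / 3 = pi * (fst b + snd b) / 3 + 2 * pi * n
            \<longleftrightarrow> pi * ((fst a + snd a - (fst b + snd b + 6 * of_int n)) / 3) = 0" for n :: int
          by (simp add: algebra_simps diff_divide_distrib add_divide_distrib)
        then have "pi * (fst a + snd a) / 3 = pi * (fst b + snd b) / 3 + 2 * pi * n
            \<longleftrightarrow> fst a + snd a = fst b + snd b + 6 * of_int n" for n :: int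
          by simp
        ultimately show ?thesis
          by (simp only: of_int_mult of_int_numeral)
      qed
      also have "\<dots> \<longleftrightarrow> (\<exists>k l :: int. even k \<and> even l \<and> 3 dvd k + l \<and> a = (fst b + k, snd b + l))"
      proof
        assume "\<exists>(m::int) (n::int). fst a = fst b + 2 * of_int m \<and> fst a + snd a = fst b + snd b + 6 * of_int n"
        then obtain m n :: int where "fst a = fst b + 2 * of_int m" "fst a + snd a = fst b + snd b + 6 * of_int n"
          by blast
        then have "a = (fst b + of_int (2 * m), snd b + of_int (6 * n - 2 * m))"
          by (simp add: prod_eq_iff)
        moreover have "even (2 * m)" "even (6 * n - 2 * m)" "3 dvd 2 * m + (6 * n - 2 * m)"
          by presburger+
        ultimately show "\<exists>k l :: int. even k \<and> even l \<and> 3 dvd k + l \<and> a = (fst b + k, snd b + l)"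
          by blast
      next
        assume "\<exists>k l :: int. even k \<and> even l \<and> 3 dvd k + l \<and> a = (fst b + k, snd b + l)"
        then obtain k l :: int where kl: "even k" "even l" "3 dvd k + l" "a = (fst b + k, snd b + l)"
          by blast
        then have "6 dvd k + l"
          by presburger
        then obtain m n where "k = 2 * m" "k + l = 6 * n"
          using kl(1) by (auto elim!: dvdE)
        then have "real_of_int k = 2 * m" "real_of_int k + l = 6 * n"
          by linarith+
        then show "\<exists>(m::int) (n::int). fst a = fst b + 2 * of_int m \<and> fst a + snd a = fst b + snd b + 6 * of_int n"
          by (intro exI[of _ m] exI[of _ n]) (simp add: kl(4))
      qed
      finally show ?thesis
        unfolding torus_labelling_fibres[OF f] by simp
    qed
  qed (auto simp: lattice_coords_realization)
  moreover have "q ` K = sphere 0 1 \<times> sphere 0 1"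
  proof
    show "q ` K \<subseteq> sphere 0 1 \<times> sphere 0 1"
      unfolding q_def by auto
    show "sphere 0 1 \<times> sphere 0 1 \<subseteq> q ` K"
    proof clarify
      fix x y :: complex
      assume "x \<in> sphere 0 1" "y \<in> sphere 0 1"
      then have "norm x = 1" "norm y = 1"
        by simp_all
      then obtain \<alpha> \<beta> where \<alpha>: "0 \<le> \<alpha>" "\<alpha> < 2 * pi" "x = cis \<alpha>" and \<beta>: "0 \<le> \<beta>" "\<beta> < 2 * pi" "y = cis \<beta>"
        using unit_circle_cis by metis
      define u where "u = \<alpha> / pi"
      define m where "m = 3 * \<beta> / pi"
      have u: "0 \<le> u" "u < 2" "x = cis (pi * u)" and m: "0 \<le> m" "m < 6" "y = cis (pi * m / 3)"
        unfolding u_def m_def using \<alpha> \<beta> by (auto simp: field_simps)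
      \<comment> \<open>\<open>u + v\<close> has to be \<open>m\<close> modulo 6, and \<open>v\<close> has to lie between 0 and 6.\<close>
      define v where "v = (if u \<le> m then m - u else m - u + 6)"
      have "cis (pi * (u + v) / 3) = y"
        unfolding m(3) cis_eq_iff v_def by (auto simp: field_simps intro: exI[of _ 0] exI[of _ 1])
      then have "(x, y) = q (u, v)"
        unfolding q_def using u(3) by simp
      moreover have "(u, v) \<in> K"
        unfolding K_def v_def using u m by auto
      ultimately show "(x, y) \<in> q ` K"
        by blast
    qed
  qed
  ultimately show ?thesis
    by simp
qed

section \<open>The sphere as a quotient of the suspended line\<close>

definition tent :: "real \<Rightarrow> real" where
  "tent t = max 0 (1 - \<bar>t\<bar>)"

fun prism_coords :: "real \<times> real \<Rightarrow> int + bool \<Rightarrow> real" where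
  "prism_coords p (Inl i) = (1 - \<bar>snd p\<bar>) * tent (fst p - i)"
| "prism_coords p (Inr b) = max 0 (if b then snd p else - snd p)"

text \<open>The suspension of the triangulated real line; \<open>Inr True\<close> and \<open>Inr False\<close> are
the upper and the lower pole.\<close>
definition suspended_line :: "(int + bool) set set" where
  "suspended_line = {\<sigma>. \<exists>i b. \<sigma> \<subseteq> {Inl i, Inl (i + 1), Inr b}}"

lemma prism_coords_eq:
  assumes "0 \<le> r" "r \<le> 1" "\<bar>s\<bar> \<le> 1"
  shows "prism_coords (of_int i + r, s) =
    (\<lambda>w. if w = Inl i then (1 - \<bar>s\<bar>) * (1 - r) else if w = Inl (i + 1) then (1 - \<bar>s\<bar>) * r
         else if w = Inr (s \<ge> 0) then \<bar>s\<bar> else 0)"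
proof
  fix w
  show "prism_coords (of_int i + r, s) w = (if w = Inl i then (1 - \<bar>s\<bar>) * (1 - r)
    else if w = Inl (i + 1) then (1 - \<bar>s\<bar>) * r else if w = Inr (s \<ge> 0) then \<bar>s\<bar> else 0)"
  proof (cases w)
    case (Inl j)
    have "tent (of_int i + r - j) = (if j = i then 1 - r else if j = i + 1 then r else 0)"
    proof -
      consider "j \<le> i - 1" | "j = i" | "j = i + 1" | "j \<ge> i + 2" by linarith
      then show ?thesis
      proof cases
        case 1
        then have "of_int j \<le> real_of_int i - 1" by linarith
        with 1 assms show ?thesis by (simp add: tent_def)
      next
        case 4
        then have "of_int j \<ge> real_of_int i + 2" by linarith
        with 4 assms show ?thesis by (simp add: tent_def)
      qed (use assms in \<open>auto simp: tent_def\<close>)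
    qed
    then show ?thesis using Inl by simp
  qed (use assms in auto)
qed

lemma
  assumes "\<bar>snd p\<bar> \<le> 1"
  shows finite_support_prism_coords: "finite {w. prism_coords p w \<noteq> 0}"
    and prism_coords_realization: "prism_coords p \<in> geometric_realization suspended_line"
proof -
  define i where "i = \<lfloor>fst p\<rfloor>"
  define r where "r = frac (fst p)"
  define s where "s = snd p"
  have p: "p = (of_int i + r, s)"
    unfolding i_def r_def s_def frac_def by simp
  have r: "0 \<le> r" "r \<le> 1" "\<bar>s\<bar> \<le> 1"
    unfolding r_def s_def using assms frac_lt_1 less_imp_le by auto
  let ?W = "{Inl i, Inl (i + 1), Inr (s \<ge> 0)}"
  have supp: "{w. prism_coords p w \<noteq> 0} \<subseteq> ?W"
    unfolding p prism_coords_eq[OF r] by auto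
  then show "finite {w. prism_coords p w \<noteq> 0}"
    by (rule finite_subset) simp
  have "{w. prism_coords p w \<noteq> 0} \<in> suspended_line"
    using supp unfolding suspended_line_def by blast
  moreover have "(\<Sum>w | prism_coords p w \<noteq> 0. prism_coords p w) = sum (prism_coords p) ?W"
    by (rule sum.mono_neutral_left) (use supp in auto)
  then have "(\<Sum>w | prism_coords p w \<noteq> 0. prism_coords p w) = 1"
    unfolding p prism_coords_eq[OF r] by (simp add: algebra_simps)
  moreover have "0 \<le> prism_coords p w" for w
    unfolding p prism_coords_eq[OF r] using r by auto
  ultimately show "prism_coords p \<in> geometric_realization suspended_line"
    unfolding geometric_realization_def by simp
qed

definition suspension_labelling :: "int \<Rightarrow> (int + bool \<Rightarrow> 'v) \<Rightarrow> bool" where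
  "suspension_labelling n f \<longleftrightarrow>
     (\<forall>i j. f (Inl i) = f (Inl j) \<longleftrightarrow> n dvd i - j) \<and> (\<forall>i b. f (Inl i) \<noteq> f (Inr b)) \<and> f (Inr True) \<noteq> f (Inr False)"

lemma suspension_labelling_D:
  assumes "suspension_labelling n f"
  shows "f (Inl i) = f (Inl j) \<longleftrightarrow> n dvd i - j" "f (Inl i) \<noteq> f (Inr b)" "f (Inr b) \<noteq> f (Inl i)"
    "f (Inr b) = f (Inr c) \<longleftrightarrow> b = c"
  using assms unfolding suspension_labelling_def by (metis (full_types))+

lemma suspension_labelling_inj_star:
  assumes f: "suspension_labelling n f" and n: "n \<ge> 3"
  shows "inj_on f {Inl (i - 1), Inl i, Inl (i + 1), Inr True, Inr False}"
proof -
  have "\<not> n dvd 1" "\<not> n dvd 2" "\<not> n dvd - 1" "\<not> n dvd - 2"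
    using n zdvd_not_zless[of 1 n] zdvd_not_zless[of 2 n] by simp_all
  then show ?thesis
    by (auto simp: inj_on_def suspension_labelling_D[OF f])
qed

text \<open>The coordinates of the poles determine the height. Away from the poles the argument is that for the
torus: translate by a multiple of \<open>n\<close> until the supports share a vertex of the line, and use that
labels are injective near it.\<close>
lemma suspension_labelling_fibres:
  fixes p q :: "real \<times> real"
  assumes f: "suspension_labelling n f" and n: "n \<ge> 3"
    and p: "\<bar>snd p\<bar> \<le> 1" and q: "\<bar>snd q\<bar> \<le> 1"
  shows "pushforward f (prism_coords p) = pushforward f (prism_coords q) \<longleftrightarrow>
    snd p = snd q \<and> (\<bar>snd p\<bar> = 1 \<or> (\<exists>k :: int. fst p = fst q + n * k))" (is "?L \<longleftrightarrow> ?R")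
proof -
  note fD = suspension_labelling_D[OF f]
  have trans: "pushforward f (prism_coords (fst x + n * k, snd x)) = pushforward f (prism_coords x)"
    for x :: "real \<times> real" and k :: int
  proof (rule pushforward_reindex[where \<tau> = "map_sum (\<lambda>i. i + n * k) id" and \<sigma> = "map_sum (\<lambda>i. i - n * k) id"])
    fix w :: "int + bool"
    show "f (map_sum (\<lambda>i. i + n * k) id w) = f w"
      by (cases w) (simp_all add: fD)
    show "prism_coords (fst x + n * k, snd x) (map_sum (\<lambda>i. i + n * k) id w) = prism_coords x w"
      by (cases w) simp_all
    show "map_sum (\<lambda>i. i - n * k) id (map_sum (\<lambda>i. i + n * k) id w) = w"
         "map_sum (\<lambda>i. i + n * k) id (map_sum (\<lambda>i. i - n * k) id w) = w"
      by (cases w; simp)+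
  qed
  show ?thesis
  proof
    assume ?R
    then consider "snd p = snd q" "\<bar>snd q\<bar> = 1" | k where "p = (fst q + n * k, snd q)"
      by (auto simp: prod_eq_iff)
    then show ?L
    proof cases
      case 1
      have "prism_coords p w = prism_coords q w" for w
        by (cases w) (use 1 in simp_all)
      then have "prism_coords p = prism_coords q"
        by (rule ext)
      then show ?L
        by (rule arg_cong)
    qed (use trans[of q] in simp)
  next
    assume eq: ?L
    have pole: "pushforward f (prism_coords x) (f (Inr b)) = prism_coords x (Inr b)" for x b
    proof (rule pushforward_at_unique)
      show "u = Inr b" if "f u = f (Inr b)" for u
        using that by (cases u) (simp_all add: fD)
    qed
    have s: "snd p = snd q"
      using pole[of p True] pole[of q True] pole[of p False] pole[of q False] eq by simp
    show ?R
    proof (cases "\<bar>snd p\<bar> = 1")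
      case False
      have nn: "0 \<le> prism_coords x w" if "\<bar>snd x\<bar> \<le> 1" for x w
        using prism_coords_realization[OF that] unfolding geometric_realization_def by blast
      have "f ` {w. prism_coords p w \<noteq> 0} = f ` {w. prism_coords q w \<noteq> 0}"
        using eq pushforward_support[OF finite_support_prism_coords[OF p] nn[OF p], of f]
          pushforward_support[OF finite_support_prism_coords[OF q] nn[OF q], of f] by simp
      moreover define i where "i = \<lfloor>fst p\<rfloor>"
      have i: "\<bar>fst p - i\<bar> < 1"
        unfolding i_def by linarith
      then have "prism_coords p (Inl i) \<noteq> 0"
        using False p by (simp add: tent_def)
      ultimately have "f (Inl i) \<in> f ` {w. prism_coords q w \<noteq> 0}"
        by blast
      then obtain w where w: "prism_coords q w \<noteq> 0" "f w = f (Inl i)"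
        by auto
      then obtain j where j: "w = Inl j" "n dvd i - j"
        by (cases w) (auto simp: fD dvd_diff_commute)
      then obtain k where k: "i = j + n * k"
        by (auto simp: dvd_def algebra_simps)
      define t where "t = fst q + n * k"
      have "tent (fst q - j) \<noteq> 0"
        using w(1) j(1) by auto
      then have t: "\<bar>t - i\<bar> < 1"
        unfolding t_def k tent_def by (simp split: if_splits add: max_def)
      have near: "{w. prism_coords (x, y) w \<noteq> 0} \<subseteq> {Inl (i - 1), Inl i, Inl (i + 1), Inr True, Inr False}"
        if x: "\<bar>x - of_int i\<bar> < 1" for x y :: real
      proof
        fix w assume w: "w \<in> {w. prism_coords (x, y) w \<noteq> 0}"
        show "w \<in> {Inl (i - 1), Inl i, Inl (i + 1), Inr True, Inr False}"
        proof (cases w)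
          case (Inl j)
          then have "\<bar>x - j\<bar> < 1"
            using w by (auto simp: tent_def max_def split: if_splits)
          then have "j = i - 1 \<or> j = i \<or> j = i + 1"
            using x by linarith
          then show ?thesis using Inl by auto
        qed auto
      qed
      have "prism_coords p = prism_coords (t, snd q)"
        using pushforward_inj[OF _ near[OF i] near[OF t] suspension_labelling_inj_star[OF f n],
            of "snd p" "snd q"] eq trans[of q k] unfolding t_def by simp
      then have "(1 - \<bar>snd p\<bar>) * tent (fst p - of_int j) = (1 - \<bar>snd q\<bar>) * tent (t - of_int j)" for j
        by (auto dest: fun_cong[of _ _ "Inl j"])
      then have tent: "tent (fst p - of_int j) = tent (t - of_int j)" for j
        using False unfolding s by simp
      have "x - of_int i = tent (x - of_int (i + 1)) - tent (x - of_int (i - 1))" if "\<bar>x - of_int i\<bar> < 1" for x :: real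
        using that unfolding tent_def by auto
      from this[OF i] this[OF t] have "fst p = t"
        unfolding tent by linarith
      then show ?R
        using s unfolding t_def by auto
    qed (use s in simp)
  qed
qed

lemma suspension_labelling_surj:
  assumes f: "suspension_labelling n f" and n: "n \<ge> 3"
    and y: "y \<in> geometric_realization ((`) f ` suspended_line)"
  shows "\<exists>p \<in> {0..of_int n} \<times> {-1..1}. pushforward f (prism_coords p) = y"
proof -
  note fD = suspension_labelling_D[OF f]
  have nn: "0 \<le> y v" for v
    using y unfolding geometric_realization_def by blast
  obtain \<sigma> where "\<sigma> \<in> suspended_line" "{v. y v \<noteq> 0} = f ` \<sigma>"
    using y unfolding geometric_realization_def by blast
  then obtain j b where jb: "{v. y v \<noteq> 0} \<subseteq> f ` {Inl j, Inl (j + 1), Inr b}"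
    unfolding suspended_line_def by blast
  define i where "i = j mod n"
  have i: "0 \<le> i" "i < n"
    unfolding i_def using n by auto
  have "n dvd j - i"
    unfolding i_def by simp
  then have "f (Inl j) = f (Inl i)" "f (Inl (j + 1)) = f (Inl (i + 1))"
    by (simp_all add: fD)
  with jb have supp: "{v. y v \<noteq> 0} \<subseteq> f ` {Inl i, Inl (i + 1), Inr b}"
    by simp
  define s where "s = (if b then y (f (Inr b)) else - y (f (Inr b)))"
  \<comment> \<open>At a pole all positions on the line describe the same point, so any value serves there.\<close>
  define r where "r = (if \<bar>s\<bar> = 1 then 0 else y (f (Inl (i + 1))) / (1 - \<bar>s\<bar>))"
  have inj: "inj_on f {Inl i, Inl (i + 1), Inr b}"
    by (rule inj_on_subset[OF suspension_labelling_inj_star[OF f n, of i]]) auto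
  have "sum y (f ` {Inl i, Inl (i + 1), Inr b}) = 1"
    by (rule realization_sum[OF y]) (use supp in auto)
  then have one: "y (f (Inl i)) + (y (f (Inl (i + 1))) + y (f (Inr b))) = 1"
    unfolding sum.reindex[OF inj] by simp
  have s: "\<bar>s\<bar> = y (f (Inr b))" "\<bar>s\<bar> \<le> 1"
    using nn[of "f (Inl i)"] nn[of "f (Inl (i + 1))"] nn[of "f (Inr b)"] one
    unfolding s_def by auto
  have yr: "y (f (Inl (i + 1))) = (1 - \<bar>s\<bar>) * r"
    using nn[of "f (Inl i)"] nn[of "f (Inl (i + 1))"] one s unfolding r_def by auto
  then have yl: "y (f (Inl i)) = (1 - \<bar>s\<bar>) * (1 - r)"
    using one s(1) by (simp add: algebra_simps)
  have r: "0 \<le> r" "r \<le> 1"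
  proof -
    show "0 \<le> r"
      unfolding r_def using nn s by simp
    show "r \<le> 1"
      unfolding r_def using nn[of "f (Inl i)"] one s by (auto simp: field_simps)
  qed
  note X = prism_coords_eq[OF r s(2), of i]
  have b: "Inr (s \<ge> 0) = Inr b" if "s \<noteq> 0"
    using that nn[of "f (Inr b)"] unfolding s_def by (auto split: if_splits)
  have "pushforward f (prism_coords (of_int i + r, s)) = y"
  proof (rule pushforward_eqI[OF _ _ inj supp])
    show "{w. prism_coords (of_int i + r, s) w \<noteq> 0} \<subseteq> {Inl i, Inl (i + 1), Inr b}"
      using b by (auto simp: X split: if_splits)
    show "prism_coords (of_int i + r, s) w = y (f w)" if "w \<in> {Inl i, Inl (i + 1), Inr b}" for w
      using that b s(1) by (auto simp: X yl yr)
  qed simp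
  moreover have "real_of_int i + 1 \<le> of_int n"
    using i(2) by linarith
  then have "(of_int i + r, s) \<in> {0..of_int n} \<times> {-1..1}"
    using i r s by auto
  ultimately show ?thesis ..
qed

theorem suspension_labelling_realization:
  assumes f: "suspension_labelling n f" and n: "n \<ge> 3"
  shows "geometric_realization ((`) f ` suspended_line) homeomorphic sphere (0::real^3) 1"
proof -
  define K :: "(real \<times> real) set" where "K = {0..of_int n} \<times> {-1..1}"
  \<comment> \<open>Cylindrical coordinates; the angle disappears exactly where the height is 1 or -1.\<close>
  define q where "q p = (of_real (sqrt (1 - (snd p)\<^sup>2)) * cis (2 * pi * fst p / n), snd p)"
    for p :: "real \<times> real"
  have K: "\<bar>snd p\<bar> \<le> 1" if "p \<in> K" for p
    using that unfolding K_def by auto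
  have "geometric_realization ((`) f ` suspended_line) homeomorphic q ` K"
  proof (rule quotient_realization[where X = prism_coords and W = "Inl ` {-1..n + 1} \<union> range Inr"])
    show "compact K"
      unfolding K_def by (intro compact_Times compact_Icc)
    show "{w. prism_coords p w \<noteq> 0} \<subseteq> Inl ` {-1..n + 1} \<union> range Inr" if "p \<in> K" for p
    proof
      fix w assume w: "w \<in> {w. prism_coords p w \<noteq> 0}"
      show "w \<in> Inl ` {-1..n + 1} \<union> range Inr"
      proof (cases w)
        case (Inl i)
        then have "\<bar>fst p - i\<bar> < 1"
          using w by (auto simp: tent_def max_def split: if_splits)
        moreover have "0 \<le> fst p" "fst p \<le> n"
          using that unfolding K_def by auto
        ultimately have "-1 \<le> i" "i \<le> n + 1"
          by linarith+
        then show ?thesis using Inl by simp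
      qed simp
    qed
    show "continuous_on K (\<lambda>p. prism_coords p w)" for w
    proof (cases w)
      case (Inr b)
      then show ?thesis
        by (cases b) (auto intro!: continuous_intros)
    qed (auto simp: tent_def intro!: continuous_intros)
    show "continuous_on K q"
      unfolding q_def by (intro continuous_intros) (use n in auto)
    show "\<exists>p\<in>K. pushforward f (prism_coords p) = y"
      if "y \<in> geometric_realization ((`) f ` suspended_line)" for y
      using suspension_labelling_surj[OF f n that] unfolding K_def .
    show "pushforward f (prism_coords a) = pushforward f (prism_coords b) \<longleftrightarrow> q a = q b"
      if ab: "a \<in> K" "b \<in> K" for a b
    proof -
      have "cis (2 * pi * fst a / n) = cis (2 * pi * fst b / n) \<longleftrightarrow> (\<exists>k :: int. fst a = fst b + n * k)"
      proof -
        have "2 * pi * fst a / n = 2 * pi * fst b / n + 2 * pi * k \<longleftrightarrow> fst a = fst b + n * k" for k :: int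
        proof -
          have "2 * pi * fst a / n = 2 * pi * fst b / n + 2 * pi * k
              \<longleftrightarrow> (2 * pi) * fst a = (2 * pi) * (fst b + n * k)"
            using n by (simp add: field_simps)
          then show ?thesis
            by simp
        qed
        then show ?thesis
          unfolding cis_eq_iff by simp
      qed
      moreover have "sqrt (1 - (snd a)\<^sup>2) = 0 \<longleftrightarrow> \<bar>snd a\<bar> = 1"
        by (simp add: abs_square_eq_1)
      ultimately have "q a = q b \<longleftrightarrow> snd a = snd b \<and> (\<bar>snd a\<bar> = 1 \<or> (\<exists>k :: int. fst a = fst b + n * k))"
        unfolding q_def by auto
      then show ?thesis
        unfolding suspension_labelling_fibres[OF f n K[OF ab(1)] K[OF ab(2)]] by simp
    qed
  qed (use prism_coords_realization K in auto)
  moreover have "q ` K = sphere (0 :: complex \<times> real) 1"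
  proof
    show "q ` K \<subseteq> sphere (0 :: complex \<times> real) 1"
    proof (rule image_subsetI)
      fix p
      assume "p \<in> K"
      then have "(snd p)\<^sup>2 \<le> 1"
        using K[of p] by (simp add: abs_square_le_1)
      then show "q p \<in> sphere 0 1"
        unfolding q_def by (simp add: norm_Pair norm_mult)
    qed
    show "sphere (0 :: complex \<times> real) 1 \<subseteq> q ` K"
    proof clarify
      fix z :: complex and s :: real
      assume "(z, s) \<in> sphere 0 1"
      then have zs: "(norm z)\<^sup>2 + s\<^sup>2 = 1"
        by (simp add: norm_Pair)
      then have z: "norm z = sqrt (1 - s\<^sup>2)"
        by (metis add_diff_cancel_right' norm_ge_zero real_sqrt_abs abs_of_nonneg)
      have s: "\<bar>s\<bar> \<le> 1"
        using zs zero_le_power2[of "norm z"] abs_square_le_1[of s] by linarith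
      obtain w where w: "norm w = 1" "z = of_real (norm z) * w"
      proof (cases "z = 0")
        case False
        then show ?thesis
          by (intro that[of "z / of_real (norm z)"]) (simp_all add: norm_divide)
      qed (use that[of 1] in simp)
      then obtain \<theta> where \<theta>: "0 \<le> \<theta>" "\<theta> < 2 * pi" "w = cis \<theta>"
        using unit_circle_cis by blast
      have "(z, s) = q (n * \<theta> / (2 * pi), s)"
        unfolding q_def using w \<theta>(3) z n by simp
      moreover have "(n * \<theta> / (2 * pi), s) \<in> K"
        unfolding K_def using \<theta> s n by (auto simp: field_simps)
      ultimately show "(z, s) \<in> q ` K"
        by blast
    qed
  qed
  moreover have "sphere (0 :: complex \<times> real) 1 homeomorphic sphere (0 :: real^3) 1"
    by (rule homeomorphic_spheres_gen) simp_all
  ultimately show ?thesis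
    using homeomorphic_trans by metis
qed

section \<open>Matching complexes as folded triangulations\<close>

text \<open>The labels that are equal or disjoint to a given one are those of the seven points of the star.\<close>
lemma hexagon_residues:
  fixes x y :: int
  assumes "even x \<and> even y \<longleftrightarrow> 3 dvd x + y"
  obtains i j where "(i, j) \<in> {(0,0), (1,0), (1,1), (0,1), (-1,0), (-1,-1), (0,-1)}"
    "even (x - i)" "even (y - j)" "3 dvd (x - i) + (y - j)"
proof -
  have "3 dvd x + y \<or> 3 dvd x + y - 1 \<or> 3 dvd x + y + 1"
    by presburger
  then consider "3 dvd x + y" | "3 dvd x + y - 1" | "3 dvd x + y + 1"
    by blast
  then show ?thesis
  proof cases
    case 1
    then show ?thesis
      using assms that[of 0 0] by simp
  next
    case 2
    then have "\<not> 3 dvd x + y"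
      by presburger
    then consider "odd x" "odd y" | "odd x" "even y" | "even x" "odd y"
      using assms by blast
    then show ?thesis
    proof cases
      case 1
      then show ?thesis using 2 by (intro that[of "-1" "-1"]) (simp, simp, simp, presburger)
    next
      case b: 2
      then show ?thesis using 2 by (intro that[of 1 0]) (simp, simp, simp, presburger)
    next
      case 3
      then show ?thesis using 2 by (intro that[of 0 1]) (simp, simp, simp, presburger)
    qed
  next
    case 3
    then have "\<not> 3 dvd x + y"
      by presburger
    then consider "odd x" "odd y" | "odd x" "even y" | "even x" "odd y"
      using assms by blast
    then show ?thesis
    proof cases
      case 1
      then show ?thesis using 3 by (intro that[of 1 1]) (simp, simp, simp, presburger)
    next
      case 2
      then show ?thesis using 3 by (intro that[of "-1" 0]) (simp, simp, simp, presburger)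
    next
      case b: 3
      then show ?thesis using 3 by (intro that[of 0 "-1"]) (simp, simp, simp, presburger)
    qed
  qed
qed

text \<open>A matching is contained in the labels of the star of any of its edges, and two of the six neighbours
have disjoint labels only if they are consecutive around the star. So the matching lies on a triangle.\<close>
lemma matching_complex_torus:
  assumes f: "torus_labelling f" and E: "edges G = range f"
    and disj: "\<And>a b c d. disjnt (f (a, b)) (f (c, d)) \<longleftrightarrow>
      \<not> (even (a - c) \<and> even (b - d)) \<and> \<not> 3 dvd (a - c) + (b - d)"
  shows "matching_complex G = (`) f ` plane_triangulation"
proof
  show "(`) f ` plane_triangulation \<subseteq> matching_complex G"
  proof clarify
    fix \<sigma> :: "(int \<times> int) set"
    assume "\<sigma> \<in> plane_triangulation"
    then obtain a b where "\<sigma> \<subseteq> {(a, b), (a + 1, b), (a + 1, b + 1)} \<or> \<sigma> \<subseteq> {(a, b), (a, b + 1), (a + 1, b + 1)}"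
      unfolding plane_triangulation_def by blast
    moreover have "pairwise disjnt (f ` {(a, b), (a + 1, b), (a + 1, b + 1)})"
      "pairwise disjnt (f ` {(a, b), (a, b + 1), (a + 1, b + 1)})"
      by (auto simp: pairwise_insert disj)
    ultimately have "pairwise disjnt (f ` \<sigma>)"
      by (metis pairwise_subset image_mono)
    then show "f ` \<sigma> \<in> matching_complex G"
      unfolding matching_complex_def E by blast
  qed
  show "matching_complex G \<subseteq> (`) f ` plane_triangulation"
  proof
    fix M
    assume M: "M \<in> matching_complex G"
    show "M \<in> (`) f ` plane_triangulation"
    proof (cases "M = {}")
      case True
      have "{} \<in> plane_triangulation"
        unfolding plane_triangulation_def by simp
      then show ?thesis
        using True by blast
    next
      case False
      then obtain a b where ab: "f (a, b) \<in> M"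
        using M unfolding matching_complex_def E by fastforce
      have apart: "disjnt (f u) (f v)" if "f u \<in> M" "f v \<in> M" "f u \<noteq> f v" for u v
        using M that unfolding matching_complex_def by (simp add: pairwise_def)
      define \<sigma> where "\<sigma> = {u \<in> closed_star (a, b). f u \<in> M}"
      have star: "closed_star (a, b) = {(a, b), (a + 1, b), (a + 1, b + 1), (a, b + 1),
          (a - 1, b), (a - 1, b - 1), (a, b - 1)}"
        unfolding closed_star_def by simp
      have fD: "f (c, d) = f (c', d') \<longleftrightarrow> even (c - c') \<and> even (d - d') \<and> 3 dvd (c - c') + (d - d')" for c d c' d'
        using f unfolding torus_labelling_def by blast
      have "M = f ` \<sigma>"
      proof
        show "M \<subseteq> f ` \<sigma>"
        proof
          fix m
          assume m: "m \<in> M"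
          then obtain c d where cd: "m = f (c, d)"
            using M unfolding matching_complex_def E by fastforce
          have "f (c, d) = f (a, b) \<or> disjnt (f (c, d)) (f (a, b))"
            using apart m ab cd by blast
          then have "even (c - a) \<and> even (d - b) \<longleftrightarrow> 3 dvd (c - a) + (d - b)"
            unfolding disj fD by blast
          then obtain i j where ij: "(i, j) \<in> {(0,0), (1,0), (1,1), (0,1), (-1,0), (-1,-1), (0,-1)}"
            "even (c - a - i)" "even (d - b - j)" "3 dvd (c - a - i) + (d - b - j)"
            by (rule hexagon_residues)
          then have "f (c, d) = f ((a, b) + (i, j))"
            by (simp add: fD algebra_simps)
          moreover have "(a, b) + (i, j) \<in> closed_star (a, b)"
            unfolding closed_star_def using ij(1) by (rule imageI)
          ultimately show "m \<in> f ` \<sigma>"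
            using m cd unfolding \<sigma>_def by (intro image_eqI[of _ _ "(a, b) + (i, j)"]) auto
        qed
      qed (auto simp: \<sigma>_def)
      moreover have no: "\<not> (f (c, d) \<in> M \<and> f (c', d') \<in> M)"
        if "(even (c - c') \<and> even (d - d')) \<noteq> (3 dvd (c - c') + (d - d'))" for c d c' d'
        using apart[of "(c, d)" "(c', d')"] that disj fD by blast
      have "\<sigma> \<in> plane_triangulation"
      proof -
        \<comment> \<open>The nine pairs of neighbours of \<open>(a, b)\<close> that are not adjacent to each other.\<close>
        have "\<not> (f (a + 1, b) \<in> M \<and> f (a - 1, b) \<in> M)" "\<not> (f (a, b + 1) \<in> M \<and> f (a, b - 1) \<in> M)"
          "\<not> (f (a + 1, b + 1) \<in> M \<and> f (a - 1, b - 1) \<in> M)" "\<not> (f (a + 1, b) \<in> M \<and> f (a, b + 1) \<in> M)"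
          "\<not> (f (a + 1, b) \<in> M \<and> f (a - 1, b - 1) \<in> M)" "\<not> (f (a, b + 1) \<in> M \<and> f (a - 1, b - 1) \<in> M)"
          "\<not> (f (a - 1, b) \<in> M \<and> f (a, b - 1) \<in> M)" "\<not> (f (a - 1, b) \<in> M \<and> f (a + 1, b + 1) \<in> M)"
          "\<not> (f (a, b - 1) \<in> M \<and> f (a + 1, b + 1) \<in> M)"
          by (rule no; simp)+
        then consider "f (a, b + 1) \<notin> M" "f (a - 1, b) \<notin> M" "f (a - 1, b - 1) \<notin> M" "f (a, b - 1) \<notin> M"
          | "f (a + 1, b) \<notin> M" "f (a - 1, b) \<notin> M" "f (a - 1, b - 1) \<notin> M" "f (a, b - 1) \<notin> M"
          | "f (a + 1, b) \<notin> M" "f (a + 1, b + 1) \<notin> M" "f (a - 1, b - 1) \<notin> M" "f (a, b - 1) \<notin> M"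
          | "f (a + 1, b) \<notin> M" "f (a + 1, b + 1) \<notin> M" "f (a, b + 1) \<notin> M" "f (a, b - 1) \<notin> M"
          | "f (a + 1, b) \<notin> M" "f (a + 1, b + 1) \<notin> M" "f (a, b + 1) \<notin> M" "f (a - 1, b) \<notin> M"
          | "f (a + 1, b + 1) \<notin> M" "f (a, b + 1) \<notin> M" "f (a - 1, b) \<notin> M" "f (a - 1, b - 1) \<notin> M"
          by argo
        then show ?thesis
        proof cases
          case 1
          then have "\<sigma> \<subseteq> {(a, b), (a + 1, b), (a + 1, b + 1)}"
            unfolding \<sigma>_def star by auto
          then show ?thesis
            unfolding plane_triangulation_def mem_Collect_eq
            by (intro exI[of _ a] exI[of _ b]) simp
        next
          case 2
          then have "\<sigma> \<subseteq> {(a, b), (a, b + 1), (a + 1, b + 1)}"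
            unfolding \<sigma>_def star by auto
          then show ?thesis
            unfolding plane_triangulation_def mem_Collect_eq
            by (intro exI[of _ a] exI[of _ b]) simp
        next
          case 3
          then have "\<sigma> \<subseteq> {(a - 1, b), (a, b), (a, b + 1)}"
            unfolding \<sigma>_def star by auto
          then show ?thesis
            unfolding plane_triangulation_def mem_Collect_eq
            by (intro exI[of _ "a - 1"] exI[of _ b]) simp
        next
          case 4
          then have "\<sigma> \<subseteq> {(a - 1, b - 1), (a - 1, b), (a, b)}"
            unfolding \<sigma>_def star by auto
          then show ?thesis
            unfolding plane_triangulation_def mem_Collect_eq
            by (intro exI[of _ "a - 1"] exI[of _ "b - 1"]) simp
        next
          case 5
          then have "\<sigma> \<subseteq> {(a - 1, b - 1), (a, b - 1), (a, b)}"
            unfolding \<sigma>_def star by auto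
          then show ?thesis
            unfolding plane_triangulation_def mem_Collect_eq
            by (intro exI[of _ "a - 1"] exI[of _ "b - 1"]) simp
        next
          case 6
          then have "\<sigma> \<subseteq> {(a, b - 1), (a, b), (a + 1, b)}"
            unfolding \<sigma>_def star by auto
          then show ?thesis
            unfolding plane_triangulation_def mem_Collect_eq
            by (intro exI[of _ a] exI[of _ "b - 1"]) simp
        qed
      qed
      ultimately show ?thesis
        by blast
    qed
  qed
qed

text \<open>For \<open>n \<ge> 4\<close> the two neighbours of an edge on the cycle are not disjoint, so a matching
contains at most two consecutive edges of the cycle and at most one pole.\<close>
lemma matching_complex_suspension:
  assumes f: "suspension_labelling n f" and n: "n \<ge> 4" and E: "edges G = range f"
    and disj: "\<And>i j. disjnt (f (Inl i)) (f (Inl j)) \<longleftrightarrow> n dvd i - j - 1 \<or> n dvd i - j + 1"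
    and pole: "\<And>i b. disjnt (f (Inl i)) (f (Inr b))" "\<not> disjnt (f (Inr True)) (f (Inr False))"
  shows "matching_complex G = (`) f ` suspended_line"
proof
  note fD = suspension_labelling_D[OF f]
  show "(`) f ` suspended_line \<subseteq> matching_complex G"
  proof clarify
    fix \<sigma> :: "(int + bool) set"
    assume "\<sigma> \<in> suspended_line"
    then obtain i b where "\<sigma> \<subseteq> {Inl i, Inl (i + 1), Inr b}"
      unfolding suspended_line_def by blast
    moreover have "pairwise disjnt (f ` {Inl i, Inl (i + 1), Inr b})"
      by (auto simp: pairwise_insert disj pole disjnt_sym[OF pole(1)])
    ultimately have "pairwise disjnt (f ` \<sigma>)"
      by (metis pairwise_subset image_mono)
    then show "f ` \<sigma> \<in> matching_complex G"
      unfolding matching_complex_def E by blast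
  qed
  show "matching_complex G \<subseteq> (`) f ` suspended_line"
  proof
    fix M
    assume M: "M \<in> matching_complex G"
    have apart: "f u = f v \<or> disjnt (f u) (f v)" if "f u \<in> M" "f v \<in> M" for u v
      using M that unfolding matching_complex_def pairwise_def by blast
    obtain b where b: "f (Inr (\<not> b)) \<notin> M"
      using apart[of "Inr True" "Inr False"] pole(2) fD(4)[of True False] by (metis (full_types))
    obtain i where i: "\<And>j. f (Inl j) \<in> M \<Longrightarrow> f (Inl j) = f (Inl i) \<or> f (Inl j) = f (Inl (i + 1))"
    proof (cases "\<exists>i. f (Inl i) \<in> M")
      case True
      then obtain i where iM: "f (Inl i) \<in> M" ..
      have near: "f (Inl j) \<in> {f (Inl (i - 1)), f (Inl i), f (Inl (i + 1))}" if "f (Inl j) \<in> M" for j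
        using apart[OF that iM] by (auto simp: disj fD algebra_simps)
      \<comment> \<open>The positions \<open>i + 1\<close> and \<open>i - 1\<close> differ by 2, and would be equal or consecutive only if \<open>n\<close> divided 1, 2 or 3.\<close>
      have "\<not> n dvd 1" "\<not> n dvd 2" "\<not> n dvd 3"
        using n by (auto dest: zdvd_imp_le)
      then have "\<not> (f (Inl (i + 1)) \<in> M \<and> f (Inl (i - 1)) \<in> M)"
        using apart[of "Inl (i + 1)" "Inl (i - 1)"] by (auto simp: disj fD)
      then show ?thesis
        using near that[of i] that[of "i - 1"] by (metis diff_add_cancel insertE singletonD)
    qed (use that in blast)
    define \<sigma> where "\<sigma> = {u \<in> {Inl i, Inl (i + 1), Inr b}. f u \<in> M}"
    have "M = f ` \<sigma>"
    proof
      show "M \<subseteq> f ` \<sigma>"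
      proof
        fix m
        assume m: "m \<in> M"
        then obtain u where u: "m = f u"
          using M unfolding matching_complex_def E by blast
        show "m \<in> f ` \<sigma>"
        proof (cases u)
          case (Inl j)
          then show ?thesis
            using i[of j] m u unfolding \<sigma>_def by auto
        next
          case (Inr c)
          then have "c = b"
            using b m u by (cases c; cases b) auto
          then show ?thesis
            using m u Inr unfolding \<sigma>_def by auto
        qed
      qed
    qed (auto simp: \<sigma>_def)
    moreover have "\<sigma> \<in> suspended_line"
      unfolding suspended_line_def \<sigma>_def by blast
    ultimately show "M \<in> (`) f ` suspended_line"
      by blast
  qed
qed

lemma finite_simplicial_complex_matching_complex:
  assumes "finite (edges G)"
  shows "finite_simplicial_complex (matching_complex G)"
  unfolding finite_simplicial_complex_def matching_complex_def
  using assms by (auto intro: finite_subset pairwise_subset)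

lemma triangulates_graph_iso:
  assumes iso: "graph_iso G H" and G: "finite_simple_graph G" and T: "triangulates (matching_complex H) X"
  shows "triangulates (matching_complex G) X"
proof -
  obtain h where h: "inj_on h (verts G)" "edges H = (`) h ` edges G"
    using iso unfolding graph_iso_def bij_betw_def by auto
  have sub: "e \<subseteq> verts G" if "e \<in> edges G" for e
    using G that unfolding finite_simple_graph_def by blast
  have "finite (edges G)"
    using G sub unfolding finite_simple_graph_def by (meson PowI finite_Pow_iff finite_subset subsetI)
  note finG = finite_simplicial_complex_matching_complex[OF this]
  have inj: "inj_on ((`) h) (edges G)"
    using h(1) sub by (meson PowI inj_on_image_Pow inj_on_subset subsetI)
  have disj: "disjnt (h ` e) (h ` e') \<longleftrightarrow> disjnt e e'" if "e \<in> edges G" "e' \<in> edges G" for e e'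
    using inj_on_image_Int[OF h(1) sub[OF that(1)] sub[OF that(2)]] unfolding disjnt_def by (metis image_is_empty)
  have pw: "pairwise disjnt ((`) h ` M) \<longleftrightarrow> pairwise disjnt M" if "M \<subseteq> edges G" for M
  proof -
    have "inj_on ((`) h) M"
      using inj that by (rule inj_on_subset)
    then have "pairwise disjnt ((`) h ` M) \<longleftrightarrow> pairwise (\<lambda>e e'. disjnt (h ` e) (h ` e')) M"
      unfolding pairwise_def by (auto simp: inj_on_eq_iff)
    also have "\<dots> \<longleftrightarrow> pairwise disjnt M"
      unfolding pairwise_def using disj that by blast
    finally show ?thesis .
  qed
  have "matching_complex H = (`) ((`) h) ` matching_complex G"
  proof
    show "matching_complex H \<subseteq> (`) ((`) h) ` matching_complex G"
    proof
      fix N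
      assume N: "N \<in> matching_complex H"
      then obtain M where M: "M \<subseteq> edges G" "N = (`) h ` M"
        unfolding matching_complex_def h(2) by (auto simp: subset_image_iff)
      then have "M \<in> matching_complex G"
        using N pw unfolding matching_complex_def by simp
      then show "N \<in> (`) ((`) h) ` matching_complex G"
        using M(2) by blast
    qed
    show "(`) ((`) h) ` matching_complex G \<subseteq> matching_complex H"
      using pw unfolding matching_complex_def h(2) by auto
  qed
  moreover have "geometric_realization (matching_complex G) homeomorphic
      geometric_realization ((`) ((`) h) ` matching_complex G)"
  proof (rule realization_image_homeomorphic)
    show "inj_on ((`) h) (\<Union>(matching_complex G))"
      by (rule inj_on_subset[OF inj]) (auto simp: matching_complex_def)
  qed (use finG in \<open>auto simp: finite_simplicial_complex_def\<close>)
  ultimately show ?thesis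
    using T finG homeomorphic_trans unfolding triangulates_def by metis
qed

lemma triangulates_torus_K43:
  "triangulates (matching_complex (complete_bipartite_graph 4 3)) (sphere (0::complex) 1 \<times> sphere (0::complex) 1)"
proof -
  let ?G = "complete_bipartite_graph 4 3"
  define f :: "int \<times> int \<Rightarrow> (nat + nat) set" where
    "f w = {Inl (nat (fst w mod 2 + 2 * (snd w mod 2))), Inr (nat ((fst w + snd w) mod 3))}" for w
  have row: "nat (a mod 2 + 2 * (b mod 2)) = nat (c mod 2 + 2 * (d mod 2)) \<longleftrightarrow> even (a - c) \<and> even (b - d)"
    for a b c d :: int
  proof -
    have "x mod 2 = 0 \<or> x mod 2 = 1" for x :: int
      by auto
    from this[of a] this[of b] this[of c] this[of d]
    have "a mod 2 + 2 * (b mod 2) = c mod 2 + 2 * (d mod 2) \<longleftrightarrow> a mod 2 = c mod 2 \<and> b mod 2 = d mod 2"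
      by (elim disjE) simp_all
    then have "a mod 2 + 2 * (b mod 2) = c mod 2 + 2 * (d mod 2) \<longleftrightarrow> even (a - c) \<and> even (b - d)"
      by (simp add: mod_eq_dvd_iff)
    then show ?thesis
      by (simp add: eq_nat_nat_iff)
  qed
  have col: "nat ((a + b) mod 3) = nat ((c + d) mod 3) \<longleftrightarrow> 3 dvd (a - c) + (b - d)" for a b c d :: int
  proof -
    have "(a + b) mod 3 = (c + d) mod 3 \<longleftrightarrow> 3 dvd (a - c) + (b - d)"
      unfolding mod_eq_dvd_iff by (simp add: algebra_simps)
    then show ?thesis
      by (simp add: eq_nat_nat_iff)
  qed
  have f: "torus_labelling f"
    unfolding torus_labelling_def f_def by (simp add: doubleton_eq_iff row col conj_assoc)
  have "edges ?G = range f"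
  proof
    show "edges ?G \<subseteq> range f"
    proof
      fix e
      assume "e \<in> edges ?G"
      then obtain i j where e: "e = {Inl i, Inr j}" "i < 4" "j < 3"
        unfolding complete_bipartite_graph_def by auto
      \<comment> \<open>By the Chinese remainder theorem: 3 is 1 modulo 2 and 0 modulo 3, while 4 is 0 modulo 2 and 1 modulo 3.\<close>
      have "i = 0 \<or> i = 1 \<or> i = 2 \<or> i = 3" "j = 0 \<or> j = 1 \<or> j = 2"
        using e(2,3) by auto
      then have "nat ((3 * (int i mod 2) + 4 * int j) mod 2 + 2 * ((3 * (int i div 2)) mod 2)) = i \<and>
          nat ((3 * (int i mod 2) + 4 * int j + 3 * (int i div 2)) mod 3) = j"
        by (elim disjE) simp_all
      then have "e = f (3 * (int i mod 2) + 4 * int j, 3 * (int i div 2))"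
        unfolding f_def e(1) by simp
      then show "e \<in> range f"
        by blast
    qed
    have "nat (a mod 2 + 2 * (b mod 2)) < 4" "nat ((a + b) mod 3) < 3" for a b :: int
      using pos_mod_bound[of 2 a] pos_mod_bound[of 2 b] pos_mod_bound[of 3 "a + b"] by linarith+
    then show "range f \<subseteq> edges ?G"
      unfolding f_def complete_bipartite_graph_def ugraph.sel by blast
  qed
  then have M: "matching_complex ?G = (`) f ` plane_triangulation"
  proof (rule matching_complex_torus[OF f])
    show "disjnt (f (a, b)) (f (c, d)) \<longleftrightarrow> \<not> (even (a - c) \<and> even (b - d)) \<and> \<not> 3 dvd (a - c) + (b - d)" for a b c d
    proof -
      have disj: "disjnt {Inl r, Inr k} {Inl r', Inr k'} \<longleftrightarrow> r \<noteq> r' \<and> k \<noteq> k'" for r k r' k' :: nat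
        by auto
      show ?thesis
        unfolding f_def disj fst_conv snd_conv row col ..
    qed
  qed
  have "finite (edges ?G)"
  proof (rule finite_subset)
    show "edges ?G \<subseteq> Pow ({..<4} <+> {..<3})"
      unfolding complete_bipartite_graph_def by auto
  qed simp
  then show ?thesis
    unfolding triangulates_def
    using finite_simplicial_complex_matching_complex torus_labelling_realization[OF f]
    unfolding M[symmetric] by blast
qed

text \<open>The edges \<open>w 0, \<dots>, w (n - 1)\<close>, listed so that the disjoint pairs are the cyclically
consecutive ones, form the equator, and \<open>N\<close> and \<open>S\<close> are the poles.\<close>
lemma triangulates_sphere_suspension:
  fixes w :: "nat \<Rightarrow> 'a set"
  assumes E: "edges G = insert N (insert S (w ` {..<n}))" and n: "n \<ge> 4"
    and ne: "\<And>i. i < n \<Longrightarrow> w i \<noteq> {}"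
    and disj: "\<And>i j. i < n \<Longrightarrow> j < n \<Longrightarrow> disjnt (w i) (w j) \<longleftrightarrow> i = Suc j mod n \<or> j = Suc i mod n"
    and inj: "inj_on w {..<n}"
    and N: "\<And>i. i < n \<Longrightarrow> disjnt (w i) N" and S: "\<And>i. i < n \<Longrightarrow> disjnt (w i) S"
    and NS: "N \<noteq> S" "\<not> disjnt N S"
  shows "triangulates (matching_complex G) (sphere (0::real^3) 1)"
proof -
  define f where "f = case_sum (\<lambda>i. w (nat (i mod int n))) (\<lambda>b. if b then N else S)"
  have r: "nat (i mod int n) < n" for i
    using n by (simp add: nat_less_iff)
  have dvd: "int n dvd i - j \<longleftrightarrow> nat (i mod int n) = nat (j mod int n)" for i j
    using n by (simp add: mod_eq_dvd_iff[symmetric] eq_nat_nat_iff)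
  have Suc: "nat ((i + 1) mod int n) = Suc (nat (i mod int n)) mod n" for i
  proof -
    have "(i + 1) mod int n = (1 + i mod int n) mod int n"
      by (simp add: mod_simps add.commute)
    also have "\<dots> = int (Suc (nat (i mod int n)) mod n)"
      using n by (simp add: zmod_int)
    finally show ?thesis by simp
  qed
  have neq: "w i \<noteq> N" "w i \<noteq> S" if "i < n" for i
    using N[OF that] S[OF that] ne[OF that] by (auto simp: disjnt_def)
  have f: "suspension_labelling (int n) f"
    unfolding suspension_labelling_def f_def dvd
    using r inj NS(1) neq by (auto simp: inj_on_eq_iff)
  have Ef: "edges G = range f"
  proof
    have "N = f (Inr True)" "S = f (Inr False)"
      unfolding f_def by simp_all
    moreover have "w i = f (Inl (int i))" if "i < n" for i
      using that unfolding f_def by simp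
    ultimately show "edges G \<subseteq> range f"
      unfolding E by auto
    show "range f \<subseteq> edges G"
    proof (rule image_subsetI)
      fix x
      show "f x \<in> edges G"
        unfolding E f_def using r by (cases x) auto
    qed
  qed
  have M: "matching_complex G = (`) f ` suspended_line"
  proof (rule matching_complex_suspension[OF f _ Ef])
    show "int n \<ge> 4"
      using n by simp
    show "disjnt (f (Inl i)) (f (Inl j)) \<longleftrightarrow> int n dvd i - j - 1 \<or> int n dvd i - j + 1" for i j
    proof -
      have "int n dvd i - (j + 1) \<longleftrightarrow> nat (i mod int n) = Suc (nat (j mod int n)) mod n"
        unfolding dvd Suc ..
      moreover have "int n dvd (i + 1) - j \<longleftrightarrow> Suc (nat (i mod int n)) mod n = nat (j mod int n)"
        unfolding dvd Suc ..
      ultimately show ?thesis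
        unfolding f_def using disj[OF r r, of i j] by (simp add: algebra_simps eq_commute)
    qed
  qed (use N S NS r in \<open>auto simp: f_def\<close>)
  have "finite (edges G)"
    unfolding E by simp
  moreover have "geometric_realization ((`) f ` suspended_line) homeomorphic sphere (0::real^3) 1"
    using suspension_labelling_realization[OF f] n by simp
  ultimately show ?thesis
    unfolding triangulates_def M[symmetric] using finite_simplicial_complex_matching_complex by blast
qed

lemma lessThan_numerals:
  "{..<2::nat} = {0, 1}" "{..<3::nat} = {0, 1, 2}" "{..<4::nat} = {0, 1, 2, 3}"
  "{..<5::nat} = {0, 1, 2, 3, 4}" "{..<6::nat} = {0, 1, 2, 3, 4, 5}"
  by auto

lemma edges_path_3: "edges (path_graph 3) = {{0, 1}, {1, 2}}"
proof -
  have "{{i, Suc i} | i. Suc i < 3} = (\<lambda>i. {i, Suc i}) ` {..<2}"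
    by auto
  then show ?thesis
    unfolding path_graph_def lessThan_numerals by (simp add: numeral_2_eq_2)
qed

lemma edges_cycle_5: "edges (cycle_graph 5) = {{0, 1}, {1, 2}, {2, 3}, {3, 4}, {4, 0}}"
proof -
  have "{{i, Suc i mod 5} | i. i < 5} = (\<lambda>i. {i, Suc i mod 5}) ` {..<5}"
    by auto
  then show ?thesis
    unfolding cycle_graph_def lessThan_numerals by (simp add: numeral_2_eq_2)
qed

lemma edges_copies_3_path_3:
  "edges (graph_copies 3 (path_graph 3)) =
    {{(0, 0), (0, 1)}, {(0, 1), (0, 2)}, {(1, 0), (1, 1)}, {(1, 1), (1, 2)}, {(2, 0), (2, 1)}, {(2, 1), (2, 2)}}"
proof -
  have "edges (graph_copies 3 (path_graph 3)) = (\<Union>i\<in>{..<3}. (`) (Pair i) ` edges (path_graph 3))"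
    unfolding graph_copies_def by auto
  also have "\<dots> = {{(0, 0), (0, 1)}, {(0, 1), (0, 2)}, {(1, 0), (1, 1)}, {(1, 1), (1, 2)}, {(2, 0), (2, 1)}, {(2, 1), (2, 2)}}"
    unfolding edges_path_3 lessThan_numerals by auto
  finally show ?thesis .
qed

lemma edges_bipartite_3_2:
  "edges (complete_bipartite_graph 3 2) =
    {{Inl 0, Inr 0}, {Inl 0, Inr 1}, {Inl 1, Inr 0}, {Inl 1, Inr 1}, {Inl 2, Inr 0}, {Inl 2, Inr 1}}"
proof -
  have "edges (complete_bipartite_graph 3 2) = (\<Union>i\<in>{..<3}. (\<lambda>j. {Inl i, Inr j}) ` {..<2})"
    unfolding complete_bipartite_graph_def by auto
  also have "\<dots> = {{Inl 0, Inr 0}, {Inl 0, Inr 1}, {Inl 1, Inr 0}, {Inl 1, Inr 1}, {Inl 2, Inr 0}, {Inl 2, Inr 1}}"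
    unfolding lessThan_numerals by auto
  finally show ?thesis .
qed

lemma triangulates_sphere_3P3:
  "triangulates (matching_complex (graph_copies 3 (path_graph 3))) (sphere (0::real^3) 1)"
proof -
  let ?w = "\<lambda>i. [{(0, 0), (0, 1)}, {(1, 0), (1, 1)}, {(0, 1), (0, 2)}, {(1, 1), (1, 2)}] ! i :: (nat \<times> nat) set"
  show ?thesis
  proof (rule triangulates_sphere_suspension[where n = 4 and w = ?w and N = "{(2, 0), (2, 1)}" and S = "{(2, 1), (2, 2)}"])
    show "edges (graph_copies 3 (path_graph 3)) = insert {(2, 0), (2, 1)} (insert {(2, 1), (2, 2)} (?w ` {..<4}))"
      unfolding edges_copies_3_path_3 lessThan_numerals(3) by (intro subset_antisym) simp_all
    show "inj_on ?w {..<4}"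
      unfolding lessThan_numerals(3) by (simp add: doubleton_eq_iff)
    fix i :: nat
    assume "i < 4"
    then have i: "i \<in> {0, 1, 2, 3}"
      unfolding lessThan_numerals(3)[symmetric] by simp
    show "?w i \<noteq> {}" "disjnt (?w i) {(2, 0), (2, 1)}" "disjnt (?w i) {(2, 1), (2, 2)}"
      using i by (elim insertE emptyE; simp)+
    fix j :: nat
    assume "j < 4"
    then have j: "j \<in> {0, 1, 2, 3}"
      unfolding lessThan_numerals(3)[symmetric] by simp
    show "disjnt (?w i) (?w j) \<longleftrightarrow> i = Suc j mod 4 \<or> j = Suc i mod 4"
      using i j by (elim insertE emptyE) simp_all
  qed (simp_all add: doubleton_eq_iff)
qed

lemma triangulates_sphere_P3_C5:
  "triangulates (matching_complex (graph_union (path_graph 3) (cycle_graph 5))) (sphere (0::real^3) 1)"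
proof -
  let ?w = "\<lambda>i. [{Inr 0, Inr 1}, {Inr 2, Inr 3}, {Inr 4, Inr 0}, {Inr 1, Inr 2}, {Inr 3, Inr 4}] ! i :: (nat + nat) set"
  show ?thesis
  proof (rule triangulates_sphere_suspension[where n = 5 and w = ?w and N = "{Inl 0, Inl 1}" and S = "{Inl 1, Inl 2}"])
    show "edges (graph_union (path_graph 3) (cycle_graph 5)) = insert {Inl 0, Inl 1} (insert {Inl 1, Inl 2} (?w ` {..<5}))"
      unfolding graph_union_def edges_path_3 edges_cycle_5 lessThan_numerals(4) by (intro subset_antisym) simp_all
    show "inj_on ?w {..<5}"
      unfolding lessThan_numerals(4) by (simp add: doubleton_eq_iff)
    fix i :: nat
    assume "i < 5"
    then have i: "i \<in> {0, 1, 2, 3, 4}"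
      unfolding lessThan_numerals(4)[symmetric] by simp
    show "?w i \<noteq> {}" "disjnt (?w i) {Inl 0, Inl 1}" "disjnt (?w i) {Inl 1, Inl 2}"
      using i by (elim insertE emptyE; simp)+
    fix j :: nat
    assume "j < 5"
    then have j: "j \<in> {0, 1, 2, 3, 4}"
      unfolding lessThan_numerals(4)[symmetric] by simp
    show "disjnt (?w i) (?w j) \<longleftrightarrow> i = Suc j mod 5 \<or> j = Suc i mod 5"
      using i j by (elim insertE emptyE) simp_all
  qed (simp_all add: doubleton_eq_iff)
qed

lemma triangulates_sphere_P3_K32:
  "triangulates (matching_complex (graph_union (path_graph 3) (complete_bipartite_graph 3 2))) (sphere (0::real^3) 1)"
proof -
  let ?w = "\<lambda>i. [{Inr (Inl 0), Inr (Inr 0)}, {Inr (Inl 1), Inr (Inr 1)}, {Inr (Inl 2), Inr (Inr 0)},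
    {Inr (Inl 0), Inr (Inr 1)}, {Inr (Inl 1), Inr (Inr 0)}, {Inr (Inl 2), Inr (Inr 1)}] ! i :: (nat + nat + nat) set"
  show ?thesis
  proof (rule triangulates_sphere_suspension[where n = 6 and w = ?w and N = "{Inl 0, Inl 1}" and S = "{Inl 1, Inl 2}"])
    show "edges (graph_union (path_graph 3) (complete_bipartite_graph 3 2)) = insert {Inl 0, Inl 1} (insert {Inl 1, Inl 2} (?w ` {..<6}))"
      unfolding graph_union_def edges_path_3 edges_bipartite_3_2 lessThan_numerals(5) by (intro subset_antisym) simp_all
    show "inj_on ?w {..<6}"
      unfolding lessThan_numerals(5) by (simp add: doubleton_eq_iff)
    fix i :: nat
    assume "i < 6"
    then have i: "i \<in> {0, 1, 2, 3, 4, 5}"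
      unfolding lessThan_numerals(5)[symmetric] by simp
    show "?w i \<noteq> {}" "disjnt (?w i) {Inl 0, Inl 1}" "disjnt (?w i) {Inl 1, Inl 2}"
      using i by (elim insertE emptyE; simp)+
    fix j :: nat
    assume "j < 6"
    then have j: "j \<in> {0, 1, 2, 3, 4, 5}"
      unfolding lessThan_numerals(5)[symmetric] by simp
    show "disjnt (?w i) (?w j) \<longleftrightarrow> i = Suc j mod 6 \<or> j = Suc i mod 6"
      using i j by (elim insertE emptyE) simp_all
  qed (simp_all add: doubleton_eq_iff)
qed

section \<open>Homology spheres of dimension zero\<close>

text \<open>All 1-chains are zero, so the homology in degree 0 is the space of 0-cycles, whose dimension is one
less than the number of points.\<close>
lemma card_vertices_of_S0:
  fixes K :: "'k::field itself" and V :: "'v set"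
  assumes V: "finite V" and L: "L = insert {} ((\<lambda>v. {v}) ` V)" and hom: "homology_iso_field K L 0"
  shows "card V = 2"
proof -
  have UL: "\<Union>L = V"
    unfolding L by auto
  have two: "c xs = 0" if c: "c \<in> oriented_chains L i" and xs: "length xs \<ge> 2" for c :: "'v list \<Rightarrow> 'k" and xs i
  proof (rule ccontr)
    assume "c xs \<noteq> 0"
    then have "distinct xs" "set xs \<in> L"
      using c unfolding oriented_chains_def by auto
    then have "card (set xs) = length xs" "card (set xs) \<le> 1"
    proof -
      show "card (set xs) = length xs"
        using \<open>distinct xs\<close> by (rule distinct_card)
      show "card (set xs) \<le> 1"
        using \<open>set xs \<in> L\<close> unfolding L by (elim insertE imageE) simp_all
    qed
    then show False
      using xs by simp
  qed
  have bd0: "boundaries L 0 = {(\<lambda>_. 0) :: 'v list \<Rightarrow> 'k}"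
  proof -
    have "c = (\<lambda>_. 0)" if c: "c \<in> oriented_chains L 1" for c :: "'v list \<Rightarrow> 'k"
    proof
      fix xs
      show "c xs = 0"
      proof (rule ccontr)
        assume nz: "c xs \<noteq> 0"
        then have "int (length xs) = 1 + 1"
          using c unfolding oriented_chains_def by blast
        then show False
          using two[OF c, of xs] nz by simp
      qed
    qed
    moreover have "(\<lambda>_. 0) \<in> (oriented_chains L 1 :: ('v list \<Rightarrow> 'k) set)"
      unfolding oriented_chains_def by simp
    ultimately have "oriented_chains L 1 = {(\<lambda>_. 0) :: 'v list \<Rightarrow> 'k}"
      by blast
    then show ?thesis
      unfolding boundaries_def by (simp add: boundary_map_def fun_eq_iff)
  qed
  have single: "hom_class L 0 z = {z}" if "z \<in> cycles L 0" for z :: "'v list \<Rightarrow> 'k"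
    using that unfolding hom_class_def homologous_def bd0 by (auto simp: fun_eq_iff)
  define d where "d u v xs = (if xs = [u] then 1 else if xs = [v] then -1 else 0 :: 'k)" for u v :: 'v and xs
  have d: "(\<lambda>xs. a * d u v xs + b * d u' v' xs) \<in> cycles L 0"
    if "u \<in> V" "v \<in> V" "u \<noteq> v" "u' \<in> V" "v' \<in> V" "u' \<noteq> v'" for u v u' v' and a b :: 'k
  proof -
    have ch: "(\<lambda>xs. a * d u v xs + b * d u' v' xs) \<in> oriented_chains L 0"
      using that unfolding oriented_chains_def d_def L by auto
    have "(\<Sum>w\<in>V. d u v (w # xs)) = 0" if "u \<in> V" "v \<in> V" "u \<noteq> v" for u v xs
    proof (cases xs)
      case Nil
      have "(\<Sum>w\<in>V. d u v [w]) = (\<Sum>w\<in>V. (if w = u then 1 else 0) + (if w = v then -1 else 0))"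
        by (rule sum.cong) (use that in \<open>auto simp: d_def\<close>)
      also have "\<dots> = 0"
        unfolding sum.distrib using V that by simp
      finally show ?thesis
        unfolding Nil .
    qed (simp add: d_def)
    then have "boundary_map L (\<lambda>xs. a * d u v xs + b * d u' v' xs) = (\<lambda>_. 0)"
      unfolding boundary_map_def UL using that by (simp add: sum.distrib flip: sum_distrib_left)
    with ch show ?thesis
      unfolding cycles_def by simp
  qed
  obtain \<phi> :: "('v list \<Rightarrow> 'k) set \<Rightarrow> 'k" where bij: "bij_betw \<phi> (reduced_homology L 0) UNIV"
    and add: "\<And>y z. y \<in> cycles L 0 \<Longrightarrow> z \<in> cycles L 0 \<Longrightarrow>
           \<phi> (hom_class L 0 (\<lambda>xs. y xs + z xs)) = \<phi> (hom_class L 0 y) + \<phi> (hom_class L 0 z)"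
    and mult: "\<And>a z. z \<in> cycles L 0 \<Longrightarrow> \<phi> (hom_class L 0 (\<lambda>xs. a * z xs)) = a * \<phi> (hom_class L 0 z)"
    using hom unfolding homology_iso_field_def by blast
  define \<psi> where "\<psi> z = \<phi> {z}" for z
  have RH: "reduced_homology L 0 = (\<lambda>z. {z}) ` (cycles L 0 :: ('v list \<Rightarrow> 'k) set)"
    unfolding reduced_homology_def quotient_def hom_class_def[symmetric] using single by auto
  have \<psi>_inj: "z = y" if "y \<in> cycles L 0" "z \<in> cycles L 0" "\<psi> y = \<psi> z" for y z
    using bij_betw_imp_inj_on[OF bij] that unfolding RH \<psi>_def by (auto simp: inj_on_def)
  have \<psi>_surj: "\<exists>z \<in> cycles L 0. \<psi> z = a" for a
  proof -
    have "a \<in> \<phi> ` reduced_homology L 0"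
      using bij_betw_imp_surj_on[OF bij] by simp
    then show ?thesis
      unfolding RH \<psi>_def by auto
  qed
  have "card V \<ge> 2"
  proof (rule ccontr)
    assume "\<not> card V \<ge> 2"
    then have uniq: "u = v" if "u \<in> V" "v \<in> V" for u v
      using that V by (metis One_nat_def card_le_Suc0_iff_eq not_less_eq_eq numeral_2_eq_2)
    have "z = (\<lambda>_. 0)" if z: "z \<in> cycles L 0" for z :: "'v list \<Rightarrow> 'k"
    proof
      fix xs
      have chain: "z \<in> oriented_chains L 0" and bd: "boundary_map L z [] = 0"
        using z unfolding cycles_def by (auto simp: fun_eq_iff)
      show "z xs = 0"
      proof (rule ccontr)
        assume nz: "z xs \<noteq> 0"
        then have "set xs \<in> L" "length xs = 1"
          using chain unfolding oriented_chains_def by auto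
        then obtain v where v: "xs = [v]" "v \<in> V"
          unfolding L by (auto simp: length_Suc_conv)
        then have "V = {v}"
          using uniq by blast
        then show False
          using bd nz v unfolding boundary_map_def UL by simp
      qed
    qed
    then show False
      using \<psi>_surj[of 0] \<psi>_surj[of 1] by (metis zero_neq_one)
  qed
  moreover have "\<not> card V \<ge> 3"
  proof
    assume "card V \<ge> 3"
    then obtain T where "T \<subseteq> V" "card T = 3"
      using obtain_subset_with_card_n by metis
    then obtain u v w where V3: "u \<in> V" "v \<in> V" "w \<in> V" and ne: "u \<noteq> v" "u \<noteq> w" "v \<noteq> w"
      by (auto simp: card_3_iff)
    have c: "d u v \<in> cycles L 0" "d u w \<in> cycles L 0"
      using d[of u v u v 1 0] d[of u w u w 1 0] V3 ne by simp_all
    define a where "a = \<psi> (d u v)"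
    define b where "b = \<psi> (d u w)"
    have cy: "(\<lambda>xs. s * d u v xs + t * d u w xs) \<in> cycles L 0" for s t :: 'k
      using d V3 ne by simp
    have lin: "\<psi> (\<lambda>xs. s * d u v xs + t * d u w xs) = s * a + t * b" for s t
    proof -
      have cs: "(\<lambda>xs. s * d u v xs) \<in> cycles L 0" "(\<lambda>xs. t * d u w xs) \<in> cycles L 0"
        using cy[of s 0] cy[of 0 t] by simp_all
      show ?thesis
        using add[OF cs] mult[OF c(1), of s] mult[OF c(2), of t] single[OF cy] single[OF cs(1)] single[OF cs(2)]
          single[OF c(1)] single[OF c(2)]
        unfolding \<psi>_def a_def b_def by simp
    qed
    have zero: "\<psi> (\<lambda>_. 0) = 0"
      using lin[of 0 0] by simp
    have z0: "(\<lambda>_. 0 :: 'k) \<in> cycles L 0"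
      using cy[of 0 0] by simp
    \<comment> \<open>The two cycles \<open>d u v\<close> and \<open>d u w\<close> are independent, but their images in the field are not.\<close>
    have "\<psi> (\<lambda>xs. b * d u v xs + (- a) * d u w xs) = \<psi> (\<lambda>_. 0)"
      unfolding lin zero by (simp add: mult.commute)
    then have eq: "(\<lambda>xs. b * d u v xs + (- a) * d u w xs) = (\<lambda>_. 0)"
      by (rule \<psi>_inj[OF z0 cy, OF sym, symmetric, THEN sym])
    have "a = 0"
      using fun_cong[OF eq, of "[w]"] ne unfolding d_def by simp
    then have "d u v = (\<lambda>_. 0)"
      using \<psi>_inj[OF c(1) z0] zero unfolding a_def by simp
    then show False
      using fun_cong[of "d u v" _ "[u]"] unfolding d_def by simp
  qed
  ultimately show ?thesis
    by simp
qed

section \<open>Graphs in which disjoint edges leave two edges\<close>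

lemma card_2_obtain:
  assumes "card e = 2" "u \<in> e"
  obtains v where "e = {u, v}" "u \<noteq> v"
proof -
  obtain a b where "e = {a, b}" "a \<noteq> b"
    using assms(1) card_2_iff by metis
  then show ?thesis
    using assms(2) that[of a] that[of b] by auto
qed

text \<open>What the manifold condition says about the edges of a graph: \<open>two\<close> comes from the links of
the faces with two edges, \<open>no_4_matching\<close> from the dimension.\<close>
locale two_completions =
  fixes E :: "'a set set"
  assumes edge_card: "e \<in> E \<Longrightarrow> card e = 2"
    and two: "\<lbrakk>e \<in> E; f \<in> E; e \<inter> f = {}\<rbrakk> \<Longrightarrow> card {g \<in> E. g \<inter> (e \<union> f) = {}} = 2"
    and no_4_matching: "\<lbrakk>e \<in> E; f \<in> E; g \<in> E; h \<in> E; e \<inter> f = {}; e \<inter> g = {}; f \<inter> g = {};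
      h \<inter> e = {}; h \<inter> f = {}; h \<inter> g = {}\<rbrakk> \<Longrightarrow> False"
begin

lemma completion_eq:
  assumes "e \<in> E" "f \<in> E" "e \<inter> f = {}" and "g1 \<in> E" "g1 \<inter> (e \<union> f) = {}"
    and "g2 \<in> E" "g2 \<inter> (e \<union> f) = {}" and "g1 \<noteq> g2" and "g \<in> E" "g \<inter> (e \<union> f) = {}"
  shows "g = g1 \<or> g = g2"
proof -
  obtain a b where "{g \<in> E. g \<inter> (e \<union> f) = {}} = {a, b}"
    using two[OF assms(1-3)] card_2_iff by metis
  moreover have "g1 \<in> {g \<in> E. g \<inter> (e \<union> f) = {}}" "g2 \<in> {g \<in> E. g \<inter> (e \<union> f) = {}}"
    "g \<in> {g \<in> E. g \<inter> (e \<union> f) = {}}"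
    using assms by simp_all
  ultimately have "g1 \<in> {a, b}" "g2 \<in> {a, b}" "g \<in> {a, b}"
    by simp_all
  then show ?thesis
    using \<open>g1 \<noteq> g2\<close> by auto
qed

lemma exactly_two_of_three:
  assumes "{a, b} \<in> E" "{c, d} \<in> E" and dist: "distinct [a, b, c, d, p, q, r]"
    and rest: "\<And>g. g \<in> E \<Longrightarrow> g \<inter> {a, b, c, d} = {} \<Longrightarrow> g \<subseteq> {p, q, r}"
  shows "{p, q} \<in> E \<and> {q, r} \<in> E \<and> {p, r} \<notin> E \<or> {p, q} \<in> E \<and> {q, r} \<notin> E \<and> {p, r} \<in> E \<or>
    {p, q} \<notin> E \<and> {q, r} \<in> E \<and> {p, r} \<in> E"
proof -
  let ?N = "{g \<in> E. g \<inter> ({a, b} \<union> {c, d}) = {}}"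
  have ab: "{a, b} \<inter> {c, d} = {}"
    using dist by auto
  have "?N \<subseteq> {{p, q}, {q, r}, {p, r}}"
  proof
    fix g
    assume g: "g \<in> ?N"
    then have "card g = 2" "g \<subseteq> {p, q, r}"
      using edge_card rest[of g] by (auto simp: insert_commute)
    then show "g \<in> {{p, q}, {q, r}, {p, r}}"
      by (auto simp: card_2_iff)
  qed
  moreover have "g \<inter> ({a, b} \<union> {c, d}) = {}" if "g \<in> {{p, q}, {q, r}, {p, r}}" for g
    using that dist by auto
  ultimately have "?N = {g \<in> {{p, q}, {q, r}, {p, r}}. g \<in> E}"
    by blast
  then have "card ?N = (\<Sum>g\<in>{{p, q}, {q, r}, {p, r}}. if g \<in> E then 1 else 0)"
    by (simp only: card_eq_sum sum.inter_filter finite.intros)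
  also have "\<dots> = of_bool ({p, q} \<in> E) + of_bool ({q, r} \<in> E) + of_bool ({p, r} \<in> E)"
  proof -
    have "{p, q} \<noteq> {q, r}" "{p, q} \<noteq> {p, r}" "{q, r} \<noteq> {p, r}"
      using dist by (auto simp: doubleton_eq_iff)
    then show ?thesis
      by simp
  qed
  finally have "of_bool ({p, q} \<in> E) + of_bool ({q, r} \<in> E) + of_bool ({p, r} \<in> E) = (2::nat)"
    using two[OF assms(1,2) ab] by simp
  then show ?thesis
    by (cases "{p, q} \<in> E"; cases "{q, r} \<in> E"; cases "{p, r} \<in> E") simp_all
qed

text \<open>Of the two edges that avoid \<open>e\<close> and \<open>f\<close>, one is \<open>g\<close>; the other
one meets \<open>g\<close> since there is no matching with four edges.\<close>
lemma matching_arm: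
  assumes E: "e \<in> E" "f \<in> E" "g \<in> E" and disj: "e \<inter> f = {}" "e \<inter> g = {}" "f \<inter> g = {}"
  obtains c l x where "g = {c, l}" "{c, x} \<in> E" "x \<notin> {c, l} \<union> e \<union> f" "c \<noteq> l"
proof -
  let ?N = "{h \<in> E. h \<inter> (e \<union> f) = {}}"
  have "card ?N = 2" "g \<in> ?N"
    using two[OF E(1,2) disj(1)] E(3) disj(2,3) by auto
  then obtain h where "?N = {g, h}" "g \<noteq> h"
    by (rule card_2_obtain)
  then have h: "h \<in> E" "h \<inter> (e \<union> f) = {}" "g \<noteq> h"
    by blast+
  then have "h \<inter> g \<noteq> {}"
    using no_4_matching[OF E h(1) disj] by blast
  then obtain c where c: "c \<in> g" "c \<in> h"
    by blast
  obtain l where l: "g = {c, l}" "c \<noteq> l"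
    using card_2_obtain[OF edge_card[OF E(3)] c(1)] by metis
  obtain x where x: "h = {c, x}" "c \<noteq> x"
    using card_2_obtain[OF edge_card[OF h(1)] c(2)] by metis
  show ?thesis
    by (rule that[of c l x]) (use l x h in auto)
qed

text \<open>Arm \<open>i\<close> is the path with centre \<open>c\<^sub>i\<close> and ends \<open>l\<^sub>i\<close>
and \<open>x\<^sub>i\<close>. The vertices \<open>x\<^sub>i\<close> of different arms may coincide.\<close>
definition frame :: "'a \<Rightarrow> 'a \<Rightarrow> 'a \<Rightarrow> 'a \<Rightarrow> 'a \<Rightarrow> 'a \<Rightarrow> 'a \<Rightarrow> 'a \<Rightarrow> 'a \<Rightarrow> bool" where
  "frame c1 l1 x1 c2 l2 x2 c3 l3 x3 \<longleftrightarrow> distinct [c1, l1, c2, l2, c3, l3] \<and>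
     {x1, x2, x3} \<inter> {c1, l1, c2, l2, c3, l3} = {} \<and>
     {{c1, l1}, {c1, x1}, {c2, l2}, {c2, x2}, {c3, l3}, {c3, x3}} \<subseteq> E"

lemma frame_exists:
  assumes E: "e \<in> E" "f \<in> E" "g \<in> E" and disj: "e \<inter> f = {}" "e \<inter> g = {}" "f \<inter> g = {}"
  obtains c1 l1 x1 c2 l2 x2 c3 l3 x3 where "frame c1 l1 x1 c2 l2 x2 c3 l3 x3"
proof -
  obtain c1 l1 x1 where 1: "e = {c1, l1}" "{c1, x1} \<in> E" "x1 \<notin> {c1, l1} \<union> f \<union> g" "c1 \<noteq> l1"
    by (rule matching_arm[of f g e]) (use E disj in auto)
  obtain c2 l2 x2 where 2: "f = {c2, l2}" "{c2, x2} \<in> E" "x2 \<notin> {c2, l2} \<union> e \<union> g" "c2 \<noteq> l2"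
    by (rule matching_arm[of e g f]) (use E disj in auto)
  obtain c3 l3 x3 where 3: "g = {c3, l3}" "{c3, x3} \<in> E" "x3 \<notin> {c3, l3} \<union> e \<union> f" "c3 \<noteq> l3"
    by (rule matching_arm[of e f g]) (use E disj in auto)
  show ?thesis
    by (rule that[of c1 l1 x1 c2 l2 x2 c3 l3 x3]) (use 1 2 3 E disj in \<open>auto simp: frame_def\<close>)
qed

lemma frame_swap:
  assumes "frame c1 l1 x1 c2 l2 x2 c3 l3 x3"
  shows "frame c2 l2 x2 c1 l1 x1 c3 l3 x3" "frame c1 l1 x1 c3 l3 x3 c2 l2 x2"
  using assms unfolding frame_def by auto

lemma frame_pendant:
  assumes F: "frame c1 l1 x1 c2 l2 x2 c3 l3 x3" and g: "g \<in> E" "g \<inter> {c2, l2} = {}" "g \<inter> {c3, l3} = {}"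
  shows "g = {c1, l1} \<or> g = {c1, x1}"
  by (rule completion_eq[of "{c2, l2}" "{c3, l3}"])
     (use F g in \<open>auto simp: frame_def doubleton_eq_iff\<close>)

lemma edge_joining:
  assumes g: "g \<in> E" "g \<inter> A \<noteq> {}" "g \<inter> B \<noteq> {}" and "A \<inter> B = {}"
  shows "\<exists>u\<in>A. \<exists>v\<in>B. g = {u, v}"
proof -
  obtain u v where uv: "u \<in> A" "u \<in> g" "v \<in> B" "v \<in> g"
    using g by blast
  then have "u \<noteq> v"
    using assms(4) by blast
  obtain w where "g = {u, w}"
    using card_2_obtain[OF edge_card[OF g(1)] uv(2)] by metis
  then have "g = {u, v}"
    using uv \<open>u \<noteq> v\<close> by auto
  then show ?thesis
    using uv by blast
qed

text \<open>An edge that meets at most one of the three matching edges avoids the other two, and is then one of the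
two known edges that do.\<close>
lemma frame_edge_cases:
  assumes F: "frame c1 l1 x1 c2 l2 x2 c3 l3 x3" and g: "g \<in> E"
  obtains (arm) "g \<in> {{c1, l1}, {c1, x1}, {c2, l2}, {c2, x2}, {c3, l3}, {c3, x3}}"
    | (cross12) u v where "u \<in> {c1, l1}" "v \<in> {c2, l2}" "g = {u, v}"
    | (cross13) u v where "u \<in> {c1, l1}" "v \<in> {c3, l3}" "g = {u, v}"
    | (cross23) u v where "u \<in> {c2, l2}" "v \<in> {c3, l3}" "g = {u, v}"
proof -
  have d: "{c1, l1} \<inter> {c2, l2} = {}" "{c1, l1} \<inter> {c3, l3} = {}" "{c2, l2} \<inter> {c3, l3} = {}"
    using F unfolding frame_def by auto
  have taut: "P2 \<and> P3 \<or> P1 \<and> P3 \<or> P1 \<and> P2 \<or> \<not> P1 \<and> \<not> P2 \<or> \<not> P1 \<and> \<not> P3 \<or> \<not> P2 \<and> \<not> P3"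
    for P1 P2 P3 by blast
  from taut[of "g \<inter> {c2, l2} = {}" "g \<inter> {c3, l3} = {}" "g \<inter> {c1, l1} = {}"] show ?thesis
  proof (elim disjE conjE)
    assume "g \<inter> {c2, l2} = {}" "g \<inter> {c3, l3} = {}"
    from frame_pendant[OF F g this] show ?thesis
      by (intro arm, elim disjE) simp_all
  next
    assume "g \<inter> {c1, l1} = {}" "g \<inter> {c3, l3} = {}"
    from frame_pendant[OF frame_swap(1)[OF F] g this] show ?thesis
      by (intro arm, elim disjE) simp_all
  next
    assume "g \<inter> {c1, l1} = {}" "g \<inter> {c2, l2} = {}"
    from frame_pendant[OF frame_swap(1)[OF frame_swap(2)[OF F]] g this] show ?thesis
      by (intro arm, elim disjE) simp_all
  next
    assume "g \<inter> {c1, l1} \<noteq> {}" "g \<inter> {c2, l2} \<noteq> {}"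
    from edge_joining[OF g this d(1)] show ?thesis
      by (elim bexE) (rule cross12)
  next
    assume "g \<inter> {c1, l1} \<noteq> {}" "g \<inter> {c3, l3} \<noteq> {}"
    from edge_joining[OF g this d(2)] show ?thesis
      by (elim bexE) (rule cross13)
  next
    assume "g \<inter> {c2, l2} \<noteq> {}" "g \<inter> {c3, l3} \<noteq> {}"
    from edge_joining[OF g this d(3)] show ?thesis
      by (elim bexE) (rule cross23)
  qed
qed

text \<open>Exchange the roles of \<open>l1\<close> and \<open>x1\<close>: the edges that avoid \<open>{c1,
x1}\<close> and \<open>{c3, l3}\<close> are \<open>{c2, l2}\<close> and \<open>{c2, x2}\<close>, so none
contains \<open>l1\<close>.\<close>
lemma frame_leaf_not_crossing:
  assumes F: "frame c1 l1 x1 c2 l2 x2 c3 l3 x3" and "x1 \<noteq> x2" and v: "v \<in> {c2, l2}"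
  shows "{l1, v} \<notin> E"
proof
  assume "{l1, v} \<in> E"
  then have "{l1, v} = {c2, l2} \<or> {l1, v} = {c2, x2}"
    by (intro completion_eq[of "{c1, x1}" "{c3, l3}"])
       (use F \<open>x1 \<noteq> x2\<close> v in \<open>auto simp: frame_def doubleton_eq_iff\<close>)
  then show False
    using F unfolding frame_def by (auto simp: doubleton_eq_iff)
qed

text \<open>By the previous lemma only \<open>{c1, c2}\<close> could join the two arms. But every edge contains
some \<open>c\<^sub>i\<close> or joins two of the arms, so none would avoid \<open>{c1, c2}\<close> and
\<open>{c3, l3}\<close>.\<close>
lemma frame_not_crossing:
  assumes F: "frame c1 l1 x1 c2 l2 x2 c3 l3 x3" and "x1 \<noteq> x2" and uv: "u \<in> {c1, l1}" "v \<in> {c2, l2}"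
  shows "{u, v} \<notin> E"
proof
  assume uvE: "{u, v} \<in> E"
  have l1: "{l1, w} \<notin> E" if "w \<in> {c2, l2}" for w
    using frame_leaf_not_crossing[OF F \<open>x1 \<noteq> x2\<close> that] .
  have l2: "{w, l2} \<notin> E" if "w \<in> {c1, l1}" for w
    using frame_leaf_not_crossing[OF frame_swap(1)[OF F] \<open>x1 \<noteq> x2\<close>[symmetric] that]
    by (simp add: insert_commute)
  have uv': "u = c1" "v = c2"
    using uv uvE l1 l2 by auto
  have "card {g \<in> E. g \<inter> ({c1, c2} \<union> {c3, l3}) = {}} = 2"
    by (rule two) (use uvE uv' F in \<open>auto simp: frame_def\<close>)
  then have "{g \<in> E. g \<inter> ({c1, c2} \<union> {c3, l3}) = {}} \<noteq> {}"
    by (intro notI) (simp only: card.empty)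
  then obtain h where h: "h \<in> E" "h \<inter> {c1, c2, c3, l3} = {}"
    by auto
  from F h(1) show False
  proof (cases rule: frame_edge_cases)
    case (cross12 u v)
    then have "h = {l1, l2}"
      using h(2) by auto
    then show False
      using h(1) l1[of l2] by simp
  qed (use h(2) in auto)
qed

lemma frame_all_distinct:
  assumes F: "frame c1 l1 x1 c2 l2 x2 c3 l3 x3" and "x1 \<noteq> x2" "x1 \<noteq> x3" "x2 \<noteq> x3"
  shows "E = {{c1, l1}, {c1, x1}, {c2, l2}, {c2, x2}, {c3, l3}, {c3, x3}}"
proof
  note no = frame_not_crossing[OF F assms(2)] frame_not_crossing[OF frame_swap(2)[OF F] assms(3)]
    frame_not_crossing[OF frame_swap(2)[OF frame_swap(1)[OF F]] assms(4)]
  show "E \<subseteq> {{c1, l1}, {c1, x1}, {c2, l2}, {c2, x2}, {c3, l3}, {c3, x3}}"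
  proof
    fix g
    assume g: "g \<in> E"
    from F g show "g \<in> {{c1, l1}, {c1, x1}, {c2, l2}, {c2, x2}, {c3, l3}, {c3, x3}}"
    proof (cases rule: frame_edge_cases)
      case (cross12 u v)
      with g no(1)[OF cross12(1,2)] show ?thesis by simp
    next
      case (cross13 u v)
      with g no(2)[OF cross13(1,2)] show ?thesis by simp
    next
      case (cross23 u v)
      with g no(3)[OF cross23(1,2)] show ?thesis by simp
    qed
  qed
  show "{{c1, l1}, {c1, x1}, {c2, l2}, {c2, x2}, {c3, l3}, {c3, x3}} \<subseteq> E"
    using F unfolding frame_def by (elim conjE)
qed

text \<open>The third arm is a component, so the edges that avoid it and one more edge lie among three vertices,
and exactly two of the three possible ones occur. Applied to \<open>{c1, x}\<close>, \<open>{c2, x}\<close>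
and \<open>{c1, c2}\<close>, this decides the four possible edges between the first two arms.\<close>
lemma frame_two_equal:
  assumes F: "frame c1 l1 x c2 l2 x c3 l3 y" and "x \<noteq> y"
  shows "E = {{l1, l2}, {c1, l1}, {c1, x}, {c2, l2}, {c2, x}, {c3, l3}, {c3, y}} \<or>
    E = {{l1, c2}, {c1, l2}, {c1, l1}, {c1, x}, {c2, l2}, {c2, x}, {c3, l3}, {c3, y}}"
proof -
  note no = frame_not_crossing[OF frame_swap(2)[OF F] assms(2)]
    frame_not_crossing[OF frame_swap(2)[OF frame_swap(1)[OF F]] assms(2)]
  let ?B = "{{c1, l1}, {c1, x}, {c2, l2}, {c2, x}, {c3, l3}, {c3, y}}"
  have B: "?B \<subseteq> E" and dist: "distinct [c1, l1, c2, l2, c3, l3, x, y]"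
    using F assms(2) unfolding frame_def by auto
  have edges: "g \<in> {{c1, c2}, {l1, c2}, {c1, l2}, {l1, l2}, {c1, l1}, {c1, x}, {c2, l2}, {c2, x}, {c3, l3}, {c3, y}}" if "g \<in> E" for g
    using F that
  proof (cases rule: frame_edge_cases)
    case (cross12 u v)
    then show ?thesis by (elim insertE emptyE) simp_all
  next
    case (cross13 u v)
    with that no(1)[OF cross13(1,2)] show ?thesis by simp
  next
    case (cross23 u v)
    with that no(2)[OF cross23(1,2)] show ?thesis by simp
  next
    case arm
    then show ?thesis by simp
  qed
  have rest: "g \<subseteq> {c1, l1, c2, l2, x}" if "g \<in> E" "g \<inter> {a, b, c3, l3} = {}" for g a b
    using edges[OF that(1)] that(2) by (elim insertE emptyE) simp_all
  have three: "{p, q} \<in> E \<and> {q, r} \<in> E \<and> {p, r} \<notin> E \<or> {p, q} \<in> E \<and> {q, r} \<notin> E \<and> {p, r} \<in> E \<or> {p, q} \<notin> E \<and> {q, r} \<in> E \<and> {p, r} \<in> E"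
    if "{a, b} \<in> E" "distinct [a, b, c3, l3, p, q, r]" "{c1, l1, c2, l2, x} = {a, b, p, q, r}" for a b p q r
  proof (rule exactly_two_of_three[OF that(1) _ that(2)])
    show "{c3, l3} \<in> E"
      using B by simp
    show "g \<subseteq> {p, q, r}" if "g \<in> E" "g \<inter> {a, b, c3, l3} = {}" for g
      using rest[OF that] that(2) unfolding \<open>{c1, l1, c2, l2, x} = {a, b, p, q, r}\<close> by blast
  qed
  have Bs: "{c1, l1} \<in> E" "{c1, x} \<in> E" "{c2, l2} \<in> E" "{c2, x} \<in> E"
    using B by simp_all
  have nx: "{l1, x} \<notin> E" "{x, l2} \<notin> E"
    using edges[of "{l1, x}"] edges[of "{x, l2}"] dist by (auto simp: doubleton_eq_iff)
  have 1: "{l1, c2} \<in> E \<longleftrightarrow> {l1, l2} \<notin> E"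
  proof -
    have "distinct [c1, x, c3, l3, l1, c2, l2]" "{c1, l1, c2, l2, x} = {c1, x, l1, c2, l2}"
      using dist by auto
    from three[OF Bs(2) this] show ?thesis
      using Bs by argo
  qed
  have 2: "{c1, l2} \<in> E \<longleftrightarrow> {l1, l2} \<notin> E"
  proof -
    have "distinct [c2, x, c3, l3, l1, c1, l2]" "{c1, l1, c2, l2, x} = {c2, x, l1, c1, l2}"
      using dist by auto
    from three[OF Bs(4) this] show ?thesis
      using Bs unfolding insert_commute[of l1 c1] by argo
  qed
  have 3: "{c1, c2} \<notin> E"
  proof
    assume c: "{c1, c2} \<in> E"
    have "distinct [c1, c2, c3, l3, l1, x, l2]" "{c1, l1, c2, l2, x} = {c1, c2, l1, x, l2}"
      using dist by auto
    from three[OF c this] show False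
      using nx by argo
  qed
  show ?thesis
  proof (cases "{l1, l2} \<in> E")
    case True
    then have "{c1, c2} \<notin> E" "{c1, l2} \<notin> E" "{l1, c2} \<notin> E"
      using 1 2 3 by simp_all
    note in_E = this
    have "E = insert {l1, l2} ?B"
    proof
      show "E \<subseteq> insert {l1, l2} ?B"
      proof
        fix g
        assume g: "g \<in> E"
        then have "g \<noteq> {c1, c2}" "g \<noteq> {c1, l2}" "g \<noteq> {l1, c2}"
          using in_E True by metis+
        with edges[OF g] show "g \<in> insert {l1, l2} ?B"
          by simp
      qed
      show "insert {l1, l2} ?B \<subseteq> E"
        using B in_E True by simp
    qed
    then show ?thesis
      by (rule disjI1)
  next
    case False
    then have "{c1, c2} \<notin> E" "{c1, l2} \<in> E" "{l1, c2} \<in> E"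
      using 1 2 3 by simp_all
    note in_E = this
    have "E = insert {l1, c2} (insert {c1, l2} ?B)"
    proof
      show "E \<subseteq> insert {l1, c2} (insert {c1, l2} ?B)"
      proof
        fix g
        assume g: "g \<in> E"
        then have "g \<noteq> {c1, c2}" "g \<noteq> {l1, l2}"
          using in_E False by metis+
        with edges[OF g] show "g \<in> insert {l1, c2} (insert {c1, l2} ?B)"
          by simp
      qed
      show "insert {l1, c2} (insert {c1, l2} ?B) \<subseteq> E"
        using B in_E False by simp
    qed
    then show ?thesis
      by (rule disjI2)
  qed
qed

text \<open>With seven vertices, every two disjoint edges leave three vertices that span exactly two edges. The
edge \<open>{c\<^sub>i, x}\<close> and an arm show that \<open>{l\<^sub>i, c\<^sub>j}\<close> is an edge if
and only if \<open>{l\<^sub>i, l\<^sub>j}\<close> is not. An edge \<open>{l1, l2}\<close> excludes \<open>{c1,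
c2}\<close>, hence forces \<open>{c1, l3}\<close> and \<open>{c2, l3}\<close>; then \<open>l1\<close>,
\<open>l2\<close>, \<open>c3\<close> span a triangle, which is one edge too many.\<close>
lemma frame_all_equal_leaves:
  assumes F: "frame c1 l1 x c2 l2 x c3 l3 x"
  shows "{l1, l2} \<notin> E \<and> {l1, c2} \<in> E \<and> {c1, c2} \<notin> E"
proof -
  let ?B = "{{c1, l1}, {c1, x}, {c2, l2}, {c2, x}, {c3, l3}, {c3, x}}"
  have B: "?B \<subseteq> E" and dist: "distinct [c1, l1, c2, l2, c3, l3, x]"
    using F unfolding frame_def by auto
  have in_V: "g \<subseteq> {c1, l1, c2, l2, c3, l3, x}" if "g \<in> E" for g
    using F that by (cases rule: frame_edge_cases) auto
  have three: "{p, q} \<in> E \<and> {q, r} \<in> E \<and> {p, r} \<notin> E \<or> {p, q} \<in> E \<and> {q, r} \<notin> E \<and> {p, r} \<in> E \<or> {p, q} \<notin> E \<and> {q, r} \<in> E \<and> {p, r} \<in> E"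
    if "{a, b} \<in> E" "{c, d} \<in> E" "distinct [a, b, c, d, p, q, r]"
      "{c1, l1, c2, l2, c3, l3, x} = {a, b, c, d, p, q, r}" for a b c d p q r
  proof (rule exactly_two_of_three[OF that(1-3)])
    show "g \<subseteq> {p, q, r}" if "g \<in> E" "g \<inter> {a, b, c, d} = {}" for g
      using in_V[OF that(1)] that(2) unfolding \<open>{c1, l1, c2, l2, c3, l3, x} = {a, b, c, d, p, q, r}\<close> by blast
  qed
  have cl: "{c1, l1} \<in> E" "{c2, l2} \<in> E" "{c3, l3} \<in> E" and cx: "{c1, x} \<in> E" "{c2, x} \<in> E" "{c3, x} \<in> E"
    using B by simp_all
  have lc: "{l1, c1} \<in> E" "{l2, c2} \<in> E" "{l3, c3} \<in> E"
    unfolding insert_commute[of l1 c1] insert_commute[of l2 c2] insert_commute[of l3 c3] by (fact cl)+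
  have nx: "{l1, x} \<notin> E" "{l2, x} \<notin> E"
  proof -
    have "{l, x} \<notin> E" if "l \<in> {l1, l2}" for l
    proof
      assume "{l, x} \<in> E"
      with F show False
        by (cases rule: frame_edge_cases) (use that dist in \<open>auto simp: doubleton_eq_iff\<close>)
    qed
    then show "{l1, x} \<notin> E" "{l2, x} \<notin> E"
      by simp_all
  qed
  have a12: "{l1, c2} \<in> E \<longleftrightarrow> {l1, l2} \<notin> E"
  proof -
    have "distinct [c1, x, c3, l3, l1, c2, l2]" "{c1, l1, c2, l2, c3, l3, x} = {c1, x, c3, l3, l1, c2, l2}"
      using dist by auto
    from three[OF cx(1) cl(3) this] show ?thesis
      using cl by argo
  qed
  have a13: "{l1, c3} \<in> E \<longleftrightarrow> {l1, l3} \<notin> E"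
  proof -
    have "distinct [c1, x, c2, l2, l1, c3, l3]" "{c1, l1, c2, l2, c3, l3, x} = {c1, x, c2, l2, l1, c3, l3}"
      using dist by auto
    from three[OF cx(1) cl(2) this] show ?thesis
      using cl by argo
  qed
  have a23: "{l2, c3} \<in> E \<longleftrightarrow> {l2, l3} \<notin> E"
  proof -
    have "distinct [c2, x, c1, l1, l2, c3, l3]" "{c1, l1, c2, l2, c3, l3, x} = {c2, x, c1, l1, l2, c3, l3}"
      using dist by auto
    from three[OF cx(2) cl(1) this] show ?thesis
      using cl by argo
  qed
  have a31: "{c1, l3} \<in> E \<longleftrightarrow> {l1, l3} \<notin> E"
  proof -
    have "distinct [c3, x, c2, l2, l1, c1, l3]" "{c1, l1, c2, l2, c3, l3, x} = {c3, x, c2, l2, l1, c1, l3}"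
      using dist by auto
    from three[OF cx(3) cl(2) this] show ?thesis
      using lc by argo
  qed
  have a32: "{c2, l3} \<in> E \<longleftrightarrow> {l2, l3} \<notin> E"
  proof -
    have "distinct [c3, x, c1, l1, l2, c2, l3]" "{c1, l1, c2, l2, c3, l3, x} = {c3, x, c1, l1, l2, c2, l3}"
      using dist by auto
    from three[OF cx(3) cl(1) this] show ?thesis
      using lc by argo
  qed
  have no_leaf_edge: "{l1, l2} \<notin> E"
  proof
    assume l: "{l1, l2} \<in> E"
    have "distinct [l1, l2, c3, l3, c1, x, c2]" "{c1, l1, c2, l2, c3, l3, x} = {l1, l2, c3, l3, c1, x, c2}"
      using dist by auto
    from three[OF l cl(3) this] have n12: "{c1, c2} \<notin> E"
      using cx unfolding insert_commute[of x c2] by argo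
    have "distinct [l1, l2, c3, x, c1, l3, c2]" "{c1, l1, c2, l2, c3, l3, x} = {l1, l2, c3, x, c1, l3, c2}"
      using dist by auto
    from three[OF l cx(3) this] have c3l: "{c1, l3} \<in> E" "{l3, c2} \<in> E"
      using n12 by argo+
    then have n: "{l1, c3} \<in> E" "{c3, l2} \<in> E"
      using a13 a23 a31 a32 by (simp_all add: insert_commute[of l3 c2] insert_commute[of c3 l2])
    have "distinct [c1, l3, c2, x, l1, c3, l2]" "{c1, l1, c2, l2, c3, l3, x} = {c1, l3, c2, x, l1, c3, l2}"
      using dist by auto
    from three[OF c3l(1) cx(2) this] show False
      using l n by argo
  qed
  moreover have "{c1, c2} \<notin> E"
  proof
    assume c: "{c1, c2} \<in> E"
    have "distinct [c1, c2, c3, l3, l1, x, l2]" "{c1, l1, c2, l2, c3, l3, x} = {c1, c2, c3, l3, l1, x, l2}"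
      using dist by auto
    from three[OF c cl(3) this] show False
      using nx unfolding insert_commute[of x l2] by argo
  qed
  ultimately show ?thesis
    using a12 by argo
qed

text \<open>All orders of the three arms are frames, so the previous lemma applies to each pair of arms.\<close>
lemma frame_all_equal:
  assumes F: "frame c1 l1 x c2 l2 x c3 l3 x"
  shows "E = {{l1, c1}, {l1, c2}, {l1, c3}, {l2, c1}, {l2, c2}, {l2, c3}, {l3, c1}, {l3, c2}, {l3, c3},
    {x, c1}, {x, c2}, {x, c3}}" (is "E = ?R")
proof -
  note s = frame_swap
  note a = frame_all_equal_leaves[OF F] frame_all_equal_leaves[OF s(1)[OF F]]
    frame_all_equal_leaves[OF s(2)[OF F]] frame_all_equal_leaves[OF s(1)[OF s(2)[OF F]]]
    frame_all_equal_leaves[OF s(2)[OF s(1)[OF F]]] frame_all_equal_leaves[OF s(1)[OF s(2)[OF s(1)[OF F]]]]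
  have cx: "{c1, x} \<in> E" "{c2, x} \<in> E" "{c3, x} \<in> E"
    and cl: "{c1, l1} \<in> E" "{c2, l2} \<in> E" "{c3, l3} \<in> E"
    using F unfolding frame_def by simp_all
  note comm = insert_commute[of c1] insert_commute[of c2] insert_commute[of c3]
  show ?thesis
  proof
    have "{x, c1} \<in> E" "{x, c2} \<in> E" "{x, c3} \<in> E"
      unfolding insert_commute[of x] by (fact cx)+
    moreover have "{l1, c1} \<in> E" "{l2, c2} \<in> E" "{l3, c3} \<in> E"
      unfolding insert_commute[of l1 c1] insert_commute[of l2 c2] insert_commute[of l3 c3] by (fact cl)+
    ultimately show "?R \<subseteq> E"
      using a by simp
    show "E \<subseteq> ?R"
    proof
      fix g
      assume g: "g \<in> E"
      from F g show "g \<in> ?R"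
      proof (cases rule: frame_edge_cases)
        case arm
        then show ?thesis
          by (elim insertE emptyE) (simp_all add: comm(1)[of l1] comm(2)[of l2] comm(3)[of l3]
              comm(1)[of x] comm(2)[of x] comm(3)[of x])
      next
        case (cross12 u v)
        with g a show ?thesis
          by (elim insertE emptyE) (simp_all add: comm(1)[of l2])
      next
        case (cross13 u v)
        with g a show ?thesis
          by (elim insertE emptyE) (simp_all add: comm(1)[of l3])
      next
        case (cross23 u v)
        with g a show ?thesis
          by (elim insertE emptyE) (simp_all add: comm(2)[of l3])
      qed
    qed
  qed
qed

lemma classification:
  assumes "e \<in> E" "f \<in> E" "g \<in> E" "e \<inter> f = {}" "e \<inter> g = {}" "f \<inter> g = {}"
  obtains
    (three_paths) c1 l1 x1 c2 l2 x2 c3 l3 x3 where "distinct [c1, l1, x1, c2, l2, x2, c3, l3, x3]"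
      "E = {{c1, l1}, {c1, x1}, {c2, l2}, {c2, x2}, {c3, l3}, {c3, x3}}"
  | (path_cycle) c1 l1 c2 l2 x c3 l3 y where "distinct [c1, l1, c2, l2, x, c3, l3, y]"
      "E = {{l1, l2}, {c1, l1}, {c1, x}, {c2, l2}, {c2, x}, {c3, l3}, {c3, y}}"
  | (path_bipartite) c1 l1 c2 l2 x c3 l3 y where "distinct [c1, l1, c2, l2, x, c3, l3, y]"
      "E = {{l1, c2}, {c1, l2}, {c1, l1}, {c1, x}, {c2, l2}, {c2, x}, {c3, l3}, {c3, y}}"
  | (bipartite) c1 l1 c2 l2 c3 l3 x where "distinct [c1, l1, c2, l2, c3, l3, x]"
      "E = {{l1, c1}, {l1, c2}, {l1, c3}, {l2, c1}, {l2, c2}, {l2, c3}, {l3, c1}, {l3, c2}, {l3, c3},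
        {x, c1}, {x, c2}, {x, c3}}"
proof -
  obtain c1 l1 x1 c2 l2 x2 c3 l3 x3 where F: "frame c1 l1 x1 c2 l2 x2 c3 l3 x3"
    using assms by (rule frame_exists)
  have two_equal: thesis if F: "frame c1 l1 x c2 l2 x c3 l3 y" and "x \<noteq> y" for c1 l1 x c2 l2 c3 l3 y
  proof -
    have "distinct [c1, l1, c2, l2, x, c3, l3, y]"
      using F \<open>x \<noteq> y\<close> unfolding frame_def by auto
    with frame_two_equal[OF that] show thesis
      using path_cycle path_bipartite by (elim disjE)
  qed
  consider "x1 \<noteq> x2" "x1 \<noteq> x3" "x2 \<noteq> x3" | "x1 = x2" "x2 \<noteq> x3" | "x1 = x3" "x2 \<noteq> x3" | "x2 = x3" "x1 \<noteq> x2"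
    | "x1 = x2" "x2 = x3"
    by fast
  then show thesis
  proof cases
    case 1
    have "distinct [c1, l1, x1, c2, l2, x2, c3, l3, x3]"
      using F 1 unfolding frame_def by auto
    then show thesis
      using frame_all_distinct[OF F 1] by (rule three_paths)
  next
    case 2
    then show thesis
      using F two_equal by simp
  next
    case 3
    have "frame c1 l1 x3 c3 l3 x3 c2 l2 x2"
      using frame_swap(2)[OF F] unfolding 3(1) .
    then show thesis
      using 3(2)[symmetric] by (rule two_equal)
  next
    case 4
    have "frame c2 l2 x3 c3 l3 x3 c1 l1 x1"
      using frame_swap(2)[OF frame_swap(1)[OF F]] unfolding 4(1) .
    then show thesis
      by (rule two_equal) (use 4 in simp)
  next
    case 5
    have F3: "frame c1 l1 x3 c2 l2 x3 c3 l3 x3"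
      using F unfolding 5 .
    then have "distinct [c1, l1, c2, l2, c3, l3, x3]"
      unfolding frame_def by auto
    then show thesis
      using frame_all_equal[OF F3] by (rule bipartite)
  qed
qed
end

section \<open>Recognizing the four graphs\<close>

lemma graph_iso_parametrization:
  assumes h: "inj_on h (verts H)" and E: "edges G = (`) h ` edges H" and V: "verts G = \<Union>(edges G)"
    and H: "verts H = \<Union>(edges H)"
  shows "graph_iso G H"
  unfolding graph_iso_def
proof (intro exI conjI)
  let ?k = "inv_into (verts H) h"
  have "verts G = h ` verts H"
    unfolding V E H by blast
  then show "bij_betw ?k (verts G) (verts H)"
    using h by (simp add: bij_betw_inv_into inj_on_imp_bij_betw)
  have "?k ` h ` e = e" if "e \<in> edges H" for e
    using h that H by (intro inv_into_image_cancel) auto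
  then show "edges H = (`) ?k ` edges G"
    unfolding E by (simp add: image_image)
qed

lemma edges_bipartite_4_3:
  "edges (complete_bipartite_graph 4 3) =
    {{Inl 0, Inr 0}, {Inl 0, Inr 1}, {Inl 0, Inr 2}, {Inl 1, Inr 0}, {Inl 1, Inr 1}, {Inl 1, Inr 2},
     {Inl 2, Inr 0}, {Inl 2, Inr 1}, {Inl 2, Inr 2}, {Inl 3, Inr 0}, {Inl 3, Inr 1}, {Inl 3, Inr 2}}"
proof -
  have "edges (complete_bipartite_graph 4 3) = (\<Union>i\<in>{..<4}. (\<lambda>j. {Inl i, Inr j}) ` {..<3})"
    unfolding complete_bipartite_graph_def by auto
  also have "\<dots> = {{Inl 0, Inr 0}, {Inl 0, Inr 1}, {Inl 0, Inr 2}, {Inl 1, Inr 0}, {Inl 1, Inr 1}, {Inl 1, Inr 2},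
     {Inl 2, Inr 0}, {Inl 2, Inr 1}, {Inl 2, Inr 2}, {Inl 3, Inr 0}, {Inl 3, Inr 1}, {Inl 3, Inr 2}}"
    unfolding lessThan_numerals by (simp add: Un_assoc) auto
  finally show ?thesis .
qed

lemma graph_iso_3P3:
  assumes d: "distinct [c1, l1, x1, c2, l2, x2, c3, l3, x3]" and V: "verts G = \<Union>(edges G)"
    and E: "edges G = {{c1, l1}, {c1, x1}, {c2, l2}, {c2, x2}, {c3, l3}, {c3, x3}}"
  shows "graph_iso G (graph_copies 3 (path_graph 3))"
proof (rule graph_iso_parametrization[OF _ _ V])
  let ?h = "\<lambda>(i, j). [[l1, c1, x1], [l2, c2, x2], [l3, c3, x3]] ! i ! j"
  have V: "verts (graph_copies 3 (path_graph 3)) = {(0,0), (0,1), (0,2), (1,0), (1,1), (1,2), (2,0), (2,1), (2,2)}"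
    unfolding graph_copies_def path_graph_def ugraph.sel lessThan_numerals by auto
  show "inj_on ?h (verts (graph_copies 3 (path_graph 3)))"
    unfolding V using d by (auto simp: numeral_2_eq_2)
  show "edges G = (`) ?h ` edges (graph_copies 3 (path_graph 3))"
    unfolding E edges_copies_3_path_3 by (simp add: numeral_2_eq_2 insert_commute[of l1] insert_commute[of l2] insert_commute[of l3])
  show "verts (graph_copies 3 (path_graph 3)) = \<Union>(edges (graph_copies 3 (path_graph 3)))"
    unfolding V edges_copies_3_path_3 by (intro subset_antisym) simp_all
qed

lemma graph_iso_P3_C5:
  assumes d: "distinct [c1, l1, c2, l2, x, c3, l3, y]" and V: "verts G = \<Union>(edges G)"
    and E: "edges G = {{l1, l2}, {c1, l1}, {c1, x}, {c2, l2}, {c2, x}, {c3, l3}, {c3, y}}"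
  shows "graph_iso G (graph_union (path_graph 3) (cycle_graph 5))"
proof (rule graph_iso_parametrization[OF _ _ V])
  let ?h = "case_sum (\<lambda>i. [l3, c3, y] ! i) (\<lambda>i. [l1, c1, x, c2, l2] ! i)"
  let ?H = "graph_union (path_graph 3) (cycle_graph 5)"
  have V: "verts ?H = {Inl 0, Inl 1, Inl 2, Inr 0, Inr 1, Inr 2, Inr 3, Inr 4}"
    unfolding graph_union_def path_graph_def cycle_graph_def ugraph.sel lessThan_numerals by auto
  have EH: "edges ?H = {{Inl 0, Inl 1}, {Inl 1, Inl 2}, {Inr 0, Inr 1}, {Inr 1, Inr 2}, {Inr 2, Inr 3}, {Inr 3, Inr 4}, {Inr 4, Inr 0}}"
    unfolding graph_union_def ugraph.sel edges_path_3 edges_cycle_5 by (intro subset_antisym) simp_all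
  show "inj_on ?h (verts ?H)"
    unfolding V using d by auto
  have "(`) ?h ` edges ?H = {{l3, c3}, {c3, y}, {l1, c1}, {c1, x}, {x, c2}, {c2, l2}, {l2, l1}}"
    unfolding EH by simp
  also have "\<dots> = edges G"
    unfolding E insert_commute[of l3 c3] insert_commute[of l1 c1] insert_commute[of x c2] insert_commute[of l2 l1]
    by (intro subset_antisym) simp_all
  finally show "edges G = (`) ?h ` edges ?H" ..
  show "verts ?H = \<Union>(edges ?H)"
    unfolding V EH by (intro subset_antisym) simp_all
qed

lemma graph_iso_P3_K32:
  assumes d: "distinct [c1, l1, c2, l2, x, c3, l3, y]" and V: "verts G = \<Union>(edges G)"
    and E: "edges G = {{l1, c2}, {c1, l2}, {c1, l1}, {c1, x}, {c2, l2}, {c2, x}, {c3, l3}, {c3, y}}"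
  shows "graph_iso G (graph_union (path_graph 3) (complete_bipartite_graph 3 2))"
proof (rule graph_iso_parametrization[OF _ _ V])
  let ?h = "case_sum (\<lambda>i. [l3, c3, y] ! i) (case_sum (\<lambda>i. [l1, l2, x] ! i) (\<lambda>i. [c1, c2] ! i))"
  let ?H = "graph_union (path_graph 3) (complete_bipartite_graph 3 2)"
  have V: "verts ?H = {Inl 0, Inl 1, Inl 2, Inr (Inl 0), Inr (Inl 1), Inr (Inl 2), Inr (Inr 0), Inr (Inr 1)}"
    unfolding graph_union_def path_graph_def complete_bipartite_graph_def ugraph.sel lessThan_numerals by auto
  have EH: "edges ?H = {{Inl 0, Inl 1}, {Inl 1, Inl 2}, {Inr (Inl 0), Inr (Inr 0)}, {Inr (Inl 0), Inr (Inr 1)},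
      {Inr (Inl 1), Inr (Inr 0)}, {Inr (Inl 1), Inr (Inr 1)}, {Inr (Inl 2), Inr (Inr 0)}, {Inr (Inl 2), Inr (Inr 1)}}"
    unfolding graph_union_def ugraph.sel edges_path_3 edges_bipartite_3_2 by (intro subset_antisym) simp_all
  show "inj_on ?h (verts ?H)"
    unfolding V using d by auto
  have "(`) ?h ` edges ?H = {{l3, c3}, {c3, y}, {l1, c1}, {l1, c2}, {l2, c1}, {l2, c2}, {x, c1}, {x, c2}}"
    unfolding EH by simp
  also have "\<dots> = edges G"
    unfolding E insert_commute[of l3 c3] insert_commute[of l1 c1] insert_commute[of l2 c1] insert_commute[of l2 c2]
      insert_commute[of x c1] insert_commute[of x c2]
    by (intro subset_antisym) simp_all
  finally show "edges G = (`) ?h ` edges ?H" ..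
  show "verts ?H = \<Union>(edges ?H)"
    unfolding V EH by (intro subset_antisym) simp_all
qed

lemma graph_iso_K43:
  assumes d: "distinct [c1, l1, c2, l2, c3, l3, x]" and V: "verts G = \<Union>(edges G)"
    and E: "edges G = {{l1, c1}, {l1, c2}, {l1, c3}, {l2, c1}, {l2, c2}, {l2, c3}, {l3, c1}, {l3, c2}, {l3, c3},
        {x, c1}, {x, c2}, {x, c3}}"
  shows "graph_iso G (complete_bipartite_graph 4 3)"
proof (rule graph_iso_parametrization[OF _ _ V])
  let ?h = "case_sum (\<lambda>i. [l1, l2, l3, x] ! i) (\<lambda>i. [c1, c2, c3] ! i)"
  let ?H = "complete_bipartite_graph 4 3"
  have V: "verts ?H = {Inl 0, Inl 1, Inl 2, Inl 3, Inr 0, Inr 1, Inr 2}"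
    unfolding complete_bipartite_graph_def ugraph.sel lessThan_numerals by auto
  show "inj_on ?h (verts ?H)"
    unfolding V using d by auto
  show "edges G = (`) ?h ` edges ?H"
    unfolding E edges_bipartite_4_3 by simp
  show "verts ?H = \<Union>(edges ?H)"
    unfolding V edges_bipartite_4_3 by (intro subset_antisym) simp_all
qed

section \<open>The classification\<close>

text \<open>A face of the link with two edges would extend \<open>{e, f}\<close> to a matching with four
edges.\<close>
lemma link_edge_pair:
  assumes G: "finite_simple_graph G" and small: "\<And>M. M \<in> matching_complex G \<Longrightarrow> card M \<le> 3"
    and ef: "e \<in> edges G" "f \<in> edges G" "e \<inter> f = {}"
  shows "link (matching_complex G) {e, f} = insert {} ((\<lambda>g. {g}) ` {g \<in> edges G. g \<inter> (e \<union> f) = {}})"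
proof -
  have ne: "g \<noteq> {}" if "g \<in> edges G" for g
    using G that unfolding finite_simple_graph_def by auto
  have finE: "finite (edges G)"
    using G unfolding finite_simple_graph_def by (meson PowI finite_Pow_iff finite_subset subsetI)
  have e_f: "e \<noteq> f"
    using ef ne[of e] by auto
  show ?thesis
  proof
    show "link (matching_complex G) {e, f} \<subseteq> insert {} ((\<lambda>g. {g}) ` {g \<in> edges G. g \<inter> (e \<union> f) = {}})"
    proof
      fix \<tau>
      assume "\<tau> \<in> link (matching_complex G) {e, f}"
      then have \<tau>: "\<tau> \<union> {e, f} \<in> matching_complex G" "\<tau> \<inter> {e, f} = {}" "\<tau> \<subseteq> edges G"
        unfolding link_def matching_complex_def by auto
      have fin: "finite \<tau>"
        using \<tau>(3) finE by (rule finite_subset)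
      have "card \<tau> + 2 = card (\<tau> \<union> {e, f})"
        using card_Un_disjoint[OF fin _ \<tau>(2)] e_f by simp
      then have "card \<tau> \<le> 1"
        using small[OF \<tau>(1)] by simp
      then have "\<tau> = {} \<or> (\<exists>g. \<tau> = {g})"
        using fin by (metis card_0_eq card_1_singletonE le_SucE le_zero_eq One_nat_def)
      then show "\<tau> \<in> insert {} ((\<lambda>g. {g}) ` {g \<in> edges G. g \<inter> (e \<union> f) = {}})"
      proof
        assume "\<exists>g. \<tau> = {g}"
        then obtain g where g: "\<tau> = {g}" ..
        then have pw: "pairwise disjnt {e, f, g}" and ne: "e \<noteq> g" "f \<noteq> g"
          using \<tau>(1,2) unfolding matching_complex_def by simp_all
        have "disjnt g e" "disjnt g f"
          using ne by (auto intro!: pairwiseD[OF pw])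
        then have "g \<inter> (e \<union> f) = {}"
          unfolding disjnt_def by blast
        then show ?thesis
          using g \<tau>(3) by simp
      qed simp
    qed
    show "insert {} ((\<lambda>g. {g}) ` {g \<in> edges G. g \<inter> (e \<union> f) = {}}) \<subseteq> link (matching_complex G) {e, f}"
    proof
      fix \<tau>
      assume "\<tau> \<in> insert {} ((\<lambda>g. {g}) ` {g \<in> edges G. g \<inter> (e \<union> f) = {}})"
      then consider "\<tau> = {}" | g where "\<tau> = {g}" "g \<in> edges G" "g \<inter> (e \<union> f) = {}"
        by auto
      then show "\<tau> \<in> link (matching_complex G) {e, f}"
      proof cases
        case 1
        have "disjnt e f" "disjnt f e"
          using ef(3) unfolding disjnt_def by blast+
        then show ?thesis
          using ef(1,2) 1 unfolding link_def matching_complex_def by (simp add: pairwise_insert)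
      next
        case 2
        then have "g \<noteq> e" "g \<noteq> f"
          using ne[OF 2(2)] by auto
        moreover have "disjnt g e" "disjnt g f" "disjnt e f" "disjnt e g" "disjnt f g" "disjnt f e"
          using 2(3) ef(3) unfolding disjnt_def by blast+
        ultimately show ?thesis
          using ef(1,2) 2(1,2) unfolding link_def matching_complex_def by (auto simp: pairwise_insert)
      qed
    qed
  qed
qed

theorem theorem4p2:
  fixes G :: "'a ugraph"
    and K :: "'k::field itself"
  assumes "finite_simple_graph G"
    and "no_isolated_vertices G"
    and "homology_manifold K 2 (matching_complex G)"
  shows "(graph_iso G (complete_bipartite_graph 4 3) \<and>
          triangulates (matching_complex G)
            (sphere (0::complex) 1 \<times> sphere (0::complex) 1)) \<or>
         ((graph_iso G (graph_copies 3 (path_graph 3)) \<or>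
           graph_iso G (graph_union (path_graph 3) (cycle_graph 5)) \<or>
           graph_iso G (graph_union (path_graph 3) (complete_bipartite_graph 3 2))) \<and>
          triangulates (matching_complex G) (sphere (0::real^3) 1))"
proof -
  let ?M = "matching_complex G"
  have fin: "finite ?M" and "{} \<in> ?M" and dim: "Max (card ` ?M) = 3"
    using assms(3) unfolding homology_manifold_def finite_simplicial_complex_def complex_dim_def by auto
  have small: "card M \<le> 3" if "M \<in> ?M" for M
    using that fin Max_ge[of "card ` ?M" "card M"] unfolding dim by simp
  have edge_card: "card e = 2" if "e \<in> edges G" for e
    using assms(1) that unfolding finite_simple_graph_def by blast
  have finE: "finite (edges G)"
    using assms(1) unfolding finite_simple_graph_def by (meson PowI finite_Pow_iff finite_subset subsetI)
  interpret two_completions "edges G"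
  proof
    show "card e = 2" if "e \<in> edges G" for e
      using edge_card[OF that] .
    show "card {g \<in> edges G. g \<inter> (e \<union> f) = {}} = 2"
      if ef: "e \<in> edges G" "f \<in> edges G" "e \<inter> f = {}" for e f
    proof -
      have "e \<noteq> f"
        using ef edge_card[of e] by auto
      then have "card {e, f} = 2"
        by simp
      moreover have "{e, f} \<in> ?M"
        using ef unfolding matching_complex_def by (auto simp: pairwise_def disjnt_def)
      ultimately have "has_homology_of_sphere K (2 - 2) (link ?M {e, f})"
        using assms(3) unfolding homology_manifold_def by fastforce
      then have "homology_iso_field K (link ?M {e, f}) 0"
        unfolding has_homology_of_sphere_def by (metis diff_self)
      then show ?thesis
        using finE link_edge_pair[OF assms(1) small ef]
        by (intro card_vertices_of_S0) auto
    qed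
    show False if "e \<in> edges G" "f \<in> edges G" "g \<in> edges G" "h \<in> edges G" "e \<inter> f = {}" "e \<inter> g = {}" "f \<inter> g = {}"
      "h \<inter> e = {}" "h \<inter> f = {}" "h \<inter> g = {}" for e f g h
    proof -
      have "{e, f, g, h} \<in> ?M"
        using that unfolding matching_complex_def by (auto simp: pairwise_def disjnt_def)
      moreover have "card {e, f, g, h} = 4"
      proof -
        have "x \<noteq> y" if "x \<inter> y = {}" "x \<in> edges G" for x y
          using that edge_card[of x] by auto
        then have "e \<noteq> f" "e \<noteq> g" "f \<noteq> g" "h \<noteq> e" "h \<noteq> f" "h \<noteq> g"
          using that by auto
        then show ?thesis
          by simp
      qed
      ultimately show False
        using small by fastforce
    qed
  qed
  have V: "verts G = \<Union>(edges G)"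
    using assms(1,2) unfolding finite_simple_graph_def no_isolated_vertices_def by blast
  have "3 \<in> card ` ?M"
    using Max_in[of "card ` ?M"] fin \<open>{} \<in> ?M\<close> unfolding dim by blast
  then obtain M where M: "M \<in> ?M" "card M = 3"
    by auto
  then obtain e f g where efg: "M = {e, f, g}" "e \<noteq> f" "f \<noteq> g" "e \<noteq> g"
    by (auto simp: card_3_iff)
  then have pw: "pairwise disjnt {e, f, g}" and "e \<in> edges G" "f \<in> edges G" "g \<in> edges G"
    using M(1) unfolding matching_complex_def by simp_all
  moreover have "disjnt e f" "disjnt e g" "disjnt f g"
    using efg by (auto intro!: pairwiseD[OF pw])
  then have "e \<inter> f = {}" "e \<inter> g = {}" "f \<inter> g = {}"
    unfolding disjnt_def by simp_all
  ultimately have "e \<in> edges G" "f \<in> edges G" "g \<in> edges G" "e \<inter> f = {}" "e \<inter> g = {}" "f \<inter> g = {}"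
    by simp_all
  then show ?thesis
  proof (cases rule: classification)
    case three_paths
    note iso = graph_iso_3P3[OF three_paths(1) V three_paths(2)]
    with triangulates_graph_iso[OF iso assms(1) triangulates_sphere_3P3] show ?thesis
      by simp
  next
    case path_cycle
    note iso = graph_iso_P3_C5[OF path_cycle(1) V path_cycle(2)]
    with triangulates_graph_iso[OF iso assms(1) triangulates_sphere_P3_C5] show ?thesis
      by simp
  next
    case path_bipartite
    note iso = graph_iso_P3_K32[OF path_bipartite(1) V path_bipartite(2)]
    with triangulates_graph_iso[OF iso assms(1) triangulates_sphere_P3_K32] show ?thesis
      by simp
  next
    case bipartite
    note iso = graph_iso_K43[OF bipartite(1) V bipartite(2)]
    with triangulates_graph_iso[OF iso assms(1) triangulates_torus_K43] show ?thesis
      by simp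
  qed
qed

end
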